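(* Let $Q$ be a finite quandle and let $\rho:Q\to GL(V)$ be an irreducible representation of $Q$ over $\mathbb{C}$. Let $s$ be a set-theoretic section of $\theta_{G(Q)}:G(Q)\to Inn(Q)$ and define $\rho_{Inn(Q)}:Inn(Q)\to PGL(V)$ by $\rho_{Inn(Q)}(a)=\overline{\rho_{G(Q)}(s(a))}$, where the overline denotes the class in $PGL(V)$. 1) $\rho_{Inn(Q)}$ is an irreducible projective representation of $Inn(Q)$ and does not depend on the choice of the section $s$. 2) For $x\in Q$, $\rho_{Inn(Q)}(L_x)=\overline{\rho(x)}$, where $\overline{\rho(x)}$ is the class of $\rho(x)$ in $PGL(V)$. 3) If $\rho':Q\to GL(W)$ is a quandle representation equivalent to $\rho$, then $\rho'_{Inn(Q)}$ is projectively equivalent to $\rho_{Inn(Q)}$. In particular, for irreducible representations $\rho,\rho'$ of $Q$, if $\rho'_{Inn(Q)}$ and $\rho_{Inn(Q)}$ are not projectively equivalent, then $\rho$ and $\rho'$ are not equivalent.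
   Context: A quandle is a set $Q$ with a binary operation $\triangleright$ such that $x\triangleright x=x$; $x\triangleright(y\triangleright z)=(x\triangleright y)\triangleright(x\triangleright z)$; and for all $x,y\in Q$ there is a unique $z\in Q$ with $x\triangleright z=y$. For $x\in Q$, $L_x:Q\to Q$ is the bijection $L_x(y)=x\triangleright y$; $Inn(Q)$ is the group of bijections of $Q$ generated by all $L_x$. A representation of $Q$ on a complex vector space $V$ is a map $\rho:Q\to GL(V)$ with $\rho(x\triangleright y)=\rho(x)\rho(y)\rho(x)^{-1}$. It is irreducible if $V\neq0$ and the only subspaces $W\subset V$ with $\rho(x)(W)\subset W$ for all $x\in Q$ are $0$ and $V$. Irreducible complex representations of a finite quandle are known to be finite dimensional. Representations $\rho$ on $V$ and $\rho'$ on $W$ are equivalent if there is a linear isomorphism $T:V\to W$ with $T\rho(x)=\rho'(x)T$ for all $x\in Q$. The enveloping group is $G(Q)=\langle x\in Q\mid xyx^{-1}=x\triangleright y,\ x,y\in Q\rangle$, with $\varphi_Q:Q\to G(Q)$ sending $x$ to the corresponding generator. $\rho_{G(Q)}:G(Q)\to GL(V)$ is the unique group morphism with $\rho_{G(Q)}\circ\varphi_Q=\rho$. $\theta_{G(Q)}:G(Q)\to Inn(Q)$ is the surjective group morphism with $\theta_{G(Q)}(\varphi_Q(x))=L_x$. It is known that $\ker\theta_{G(Q)}$ is contained in the center of $G(Q)$. A projective representation of a group $G$ is a group morphism $G\to PGL(V)$; it is irreducible if no proper projective subspace of $P(V)$ is stable under $G$. Two projective representations are projectively equivalent if they are conjugate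 by an invertible projective transformation. *)

theory Defs
  imports Complex_Main "HOL-Algebra.Bij" "HOL-Algebra.Elementary_Groups"
begin

section \<open>Groups given by generators and relations\<close>

text \<open>
  A word over \<open>X\<close> is a list of letters \<open>(b, x)\<close>; \<open>(True, x)\<close> stands for \<open>x\<close> and
  \<open>(False, x)\<close> for its formal inverse.
\<close>

definition words :: "'q set \<Rightarrow> (bool \<times> 'q) list set" where
  "words X = lists (UNIV \<times> X)"

inductive word_cong ::
  "'q set \<Rightarrow> ((bool \<times> 'q) list \<times> (bool \<times> 'q) list) set \<Rightarrow>
     (bool \<times> 'q) list \<Rightarrow> (bool \<times> 'q) list \<Rightarrow> bool"
  for X R where
  word_refl: "u \<in> words X \<Longrightarrow> word_cong X R u u"
| word_sym: "word_cong X R u v \<Longrightarrow> word_cong X R v u"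
| word_trans: "word_cong X R u v \<Longrightarrow> word_cong X R v w \<Longrightarrow> word_cong X R u w"
| word_append: "word_cong X R u u' \<Longrightarrow> word_cong X R v v' \<Longrightarrow> word_cong X R (u @ v) (u' @ v')"
| word_cancel: "x \<in> X \<Longrightarrow> word_cong X R [(b, x), (\<not> b, x)] []"
| word_relator: "(u, v) \<in> R \<Longrightarrow> u \<in> words X \<Longrightarrow> v \<in> words X \<Longrightarrow> word_cong X R u v"

definition word_rel ::
  "'q set \<Rightarrow> ((bool \<times> 'q) list \<times> (bool \<times> 'q) list) set \<Rightarrow>
     ((bool \<times> 'q) list \<times> (bool \<times> 'q) list) set" where
  "word_rel X R = {(u, v). word_cong X R u v}"

definition presented_group ::
  "'q set \<Rightarrow> ((bool \<times> 'q) list \<times> (bool \<times> 'q) list) set \<Rightarrow> (bool \<times> 'q) list set monoid" where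
  "presented_group X R =
     \<lparr>carrier = words X // word_rel X R,
      mult = (\<lambda>A B. \<Union>u\<in>A. \<Union>v\<in>B. word_rel X R `` {u @ v}),
      one = word_rel X R `` {[]}\<rparr>"

section \<open>Quandles\<close>

locale quandle =
  fixes Q :: "'q set" and qop :: "'q \<Rightarrow> 'q \<Rightarrow> 'q" (infixr "\<rhd>" 70)
  assumes closed: "x \<in> Q \<Longrightarrow> y \<in> Q \<Longrightarrow> x \<rhd> y \<in> Q"
    and idem: "x \<in> Q \<Longrightarrow> x \<rhd> x = x"
    and distrib: "x \<in> Q \<Longrightarrow> y \<in> Q \<Longrightarrow> z \<in> Q \<Longrightarrow> x \<rhd> (y \<rhd> z) = (x \<rhd> y) \<rhd> (x \<rhd> z)"
    and left_div: "x \<in> Q \<Longrightarrow> y \<in> Q \<Longrightarrow> \<exists>!z. z \<in> Q \<and> x \<rhd> z = y"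

text \<open>\<open>BijGroup Q\<close> consists of extensional functions, hence the restriction to \<open>Q\<close>.\<close>

definition left_trans :: "'q set \<Rightarrow> ('q \<Rightarrow> 'q \<Rightarrow> 'q) \<Rightarrow> 'q \<Rightarrow> 'q \<Rightarrow> 'q" where
  "left_trans Q qop x = (\<lambda>y\<in>Q. qop x y)"

definition Inn :: "'q set \<Rightarrow> ('q \<Rightarrow> 'q \<Rightarrow> 'q) \<Rightarrow> ('q \<Rightarrow> 'q) monoid" where
  "Inn Q qop = subgroup_generated (BijGroup Q) (left_trans Q qop ` Q)"

text \<open>The relations \<open>x y x\<^sup>-\<^sup>1 = x \<rhd> y\<close>.\<close>

definition env_relators ::
  "'q set \<Rightarrow> ('q \<Rightarrow> 'q \<Rightarrow> 'q) \<Rightarrow> ((bool \<times> 'q) list \<times> (bool \<times> 'q) list) set" where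
  "env_relators Q qop =
     {([(True, x), (True, y), (False, x)], [(True, qop x y)]) | x y. x \<in> Q \<and> y \<in> Q}"

definition env_group :: "'q set \<Rightarrow> ('q \<Rightarrow> 'q \<Rightarrow> 'q) \<Rightarrow> (bool \<times> 'q) list set monoid" where
  "env_group Q qop = presented_group Q (env_relators Q qop)"

definition env_gen :: "'q set \<Rightarrow> ('q \<Rightarrow> 'q \<Rightarrow> 'q) \<Rightarrow> 'q \<Rightarrow> (bool \<times> 'q) list set" where
  "env_gen Q qop x = word_rel Q (env_relators Q qop) `` {[(True, x)]}"

text \<open>
  The unique group morphism \<open>h\<close> from the enveloping group to \<open>H\<close> with \<open>h (env_gen Q qop x) = f x\<close>
  for all \<open>x \<in> Q\<close>; see \<open>env_lift_unique\<close> below. Extensionality makes it unique as a function.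
\<close>

definition env_lift ::
  "'q set \<Rightarrow> ('q \<Rightarrow> 'q \<Rightarrow> 'q) \<Rightarrow> ('h, 'm) monoid_scheme \<Rightarrow> ('q \<Rightarrow> 'h) \<Rightarrow>
     (bool \<times> 'q) list set \<Rightarrow> 'h" where
  "env_lift Q qop H f =
     (THE h. h \<in> hom (env_group Q qop) H \<and> h \<in> extensional (carrier (env_group Q qop)) \<and>
        (\<forall>x\<in>Q. h (env_gen Q qop x) = f x))"

definition env_theta ::
  "'q set \<Rightarrow> ('q \<Rightarrow> 'q \<Rightarrow> 'q) \<Rightarrow> (bool \<times> 'q) list set \<Rightarrow> 'q \<Rightarrow> 'q" where
  "env_theta Q qop = env_lift Q qop (Inn Q qop) (left_trans Q qop)"

definition theta_section ::
  "'q set \<Rightarrow> ('q \<Rightarrow> 'q \<Rightarrow> 'q) \<Rightarrow> (('q \<Rightarrow> 'q) \<Rightarrow> (bool \<times> 'q) list set) \<Rightarrow> bool" where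
  "theta_section Q qop s \<longleftrightarrow>
     (\<forall>a \<in> carrier (Inn Q qop). s a \<in> carrier (env_group Q qop) \<and> env_theta Q qop (s a) = a)"

section \<open>Linear and projective groups\<close>

text \<open>
  A complex vector space is the whole of a type \<open>'v\<close>, with an explicit scalar multiplication
  \<open>sc :: complex \<Rightarrow> 'v \<Rightarrow> 'v\<close> satisfying \<^locale>\<open>vector_space\<close>; its dimension may be infinite.
\<close>

definition lin_iso ::
  "(complex \<Rightarrow> 'v \<Rightarrow> 'v) \<Rightarrow> (complex \<Rightarrow> 'w \<Rightarrow> 'w) \<Rightarrow> ('v::ab_group_add \<Rightarrow> 'w::ab_group_add) set" where
  "lin_iso sV sW = {T. Vector_Spaces.linear sV sW T \<and> bij T}"

definition GL :: "(complex \<Rightarrow> 'v \<Rightarrow> 'v) \<Rightarrow> ('v::ab_group_add \<Rightarrow> 'v) monoid" where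
  "GL sc = \<lparr>carrier = lin_iso sc sc, mult = (\<circ>), one = id\<rparr>"

definition scalars :: "(complex \<Rightarrow> 'v \<Rightarrow> 'v) \<Rightarrow> ('v::ab_group_add \<Rightarrow> 'v) set" where
  "scalars sc = {sc c | c. c \<noteq> 0}"

definition PGL :: "(complex \<Rightarrow> 'v \<Rightarrow> 'v) \<Rightarrow> ('v::ab_group_add \<Rightarrow> 'v) set monoid" where
  "PGL sc = GL sc Mod scalars sc"

definition pgl_class ::
  "(complex \<Rightarrow> 'v \<Rightarrow> 'v) \<Rightarrow> ('v::ab_group_add \<Rightarrow> 'v) \<Rightarrow> ('v \<Rightarrow> 'v) set" where
  "pgl_class sc f = scalars sc #>\<^bsub>GL sc\<^esub> f"

definition proj_points :: "(complex \<Rightarrow> 'v \<Rightarrow> 'v) \<Rightarrow> 'v::ab_group_add set set" where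
  "proj_points sc = {module.span sc {v} | v. v \<noteq> 0}"

definition proj_subspace :: "(complex \<Rightarrow> 'v \<Rightarrow> 'v) \<Rightarrow> 'v::ab_group_add set set \<Rightarrow> bool" where
  "proj_subspace sc S \<longleftrightarrow>
     (\<exists>W. module.subspace sc W \<and> S = {l \<in> proj_points sc. l \<subseteq> W})"

text \<open>
  Action of a class \<open>F\<close> in \<open>PGL sc\<close> on a point \<open>l\<close> of projective space: all representatives
  \<open>f \<in> F\<close> give the same line \<open>f ` l\<close>, which is therefore the union below.
\<close>

definition proj_act :: "('v \<Rightarrow> 'v) set \<Rightarrow> 'v set \<Rightarrow> 'v set" where
  "proj_act F l = (\<Union>f\<in>F. f ` l)"

definition projective_rep ::
  "('g, 'm) monoid_scheme \<Rightarrow> (complex \<Rightarrow> 'v \<Rightarrow> 'v) \<Rightarrow> ('g \<Rightarrow> ('v::ab_group_add \<Rightarrow> 'v) set) \<Rightarrow> bool" where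
  "projective_rep G sc r \<longleftrightarrow> group G \<and> vector_space sc \<and> r \<in> hom G (PGL sc)"

text \<open>
  The empty set is the projective subspace of the zero subspace; it is always stable and so
  has to be excluded.
\<close>

definition irreducible_projective_rep ::
  "('g, 'm) monoid_scheme \<Rightarrow> (complex \<Rightarrow> 'v \<Rightarrow> 'v) \<Rightarrow> ('g \<Rightarrow> ('v::ab_group_add \<Rightarrow> 'v) set) \<Rightarrow> bool" where
  "irreducible_projective_rep G sc r \<longleftrightarrow>
     projective_rep G sc r \<and>
     \<not> (\<exists>S. proj_subspace sc S \<and> S \<noteq> {} \<and> S \<noteq> proj_points sc \<and>
          (\<forall>g \<in> carrier G. \<forall>l \<in> S. proj_act (r g) l \<in> S))"

text \<open>
  Invertible projective transformations between the projective spaces of two vector spaces are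
  linear isomorphisms up to nonzero scalars; for \<open>sV = sW\<close> these are the elements of \<open>PGL sV\<close>.
\<close>

definition proj_transformations ::
  "(complex \<Rightarrow> 'v \<Rightarrow> 'v) \<Rightarrow> (complex \<Rightarrow> 'w \<Rightarrow> 'w) \<Rightarrow>
     ('v::ab_group_add \<Rightarrow> 'w::ab_group_add) set set" where
  "proj_transformations sV sW = {{sW c \<circ> T | c. c \<noteq> 0} | T. T \<in> lin_iso sV sW}"

definition proj_conj :: "('v \<Rightarrow> 'w) set \<Rightarrow> ('v \<Rightarrow> 'v) set \<Rightarrow> ('w \<Rightarrow> 'w) set" where
  "proj_conj \<tau> F = {T \<circ> f \<circ> inv_into UNIV T | T f. T \<in> \<tau> \<and> f \<in> F}"

definition projectively_equivalent ::
  "('g, 'm) monoid_scheme \<Rightarrow> (complex \<Rightarrow> 'v \<Rightarrow> 'v) \<Rightarrow> ('g \<Rightarrow> ('v::ab_group_add \<Rightarrow> 'v) set) \<Rightarrow>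
     (complex \<Rightarrow> 'w \<Rightarrow> 'w) \<Rightarrow> ('g \<Rightarrow> ('w::ab_group_add \<Rightarrow> 'w) set) \<Rightarrow> bool" where
  "projectively_equivalent G sV r sW r' \<longleftrightarrow>
     (\<exists>\<tau> \<in> proj_transformations sV sW. \<forall>g \<in> carrier G. r' g = proj_conj \<tau> (r g))"

section \<open>Representations of quandles\<close>

definition quandle_rep ::
  "'q set \<Rightarrow> ('q \<Rightarrow> 'q \<Rightarrow> 'q) \<Rightarrow> (complex \<Rightarrow> 'v \<Rightarrow> 'v) \<Rightarrow> ('q \<Rightarrow> 'v::ab_group_add \<Rightarrow> 'v) \<Rightarrow> bool" where
  "quandle_rep Q qop sc \<rho> \<longleftrightarrow>
     vector_space sc \<and> (\<forall>x\<in>Q. \<rho> x \<in> carrier (GL sc)) \<and>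
     (\<forall>x\<in>Q. \<forall>y\<in>Q. \<rho> (qop x y) = \<rho> x \<otimes>\<^bsub>GL sc\<^esub> \<rho> y \<otimes>\<^bsub>GL sc\<^esub> inv\<^bsub>GL sc\<^esub> (\<rho> x))"

definition irreducible_quandle_rep ::
  "'q set \<Rightarrow> ('q \<Rightarrow> 'q \<Rightarrow> 'q) \<Rightarrow> (complex \<Rightarrow> 'v \<Rightarrow> 'v) \<Rightarrow> ('q \<Rightarrow> 'v::ab_group_add \<Rightarrow> 'v) \<Rightarrow> bool" where
  "irreducible_quandle_rep Q qop sc \<rho> \<longleftrightarrow>
     quandle_rep Q qop sc \<rho> \<and> (UNIV :: 'v set) \<noteq> {0} \<and>
     (\<forall>W. module.subspace sc W \<and> (\<forall>x\<in>Q. \<rho> x ` W \<subseteq> W) \<longrightarrow> W = {0} \<or> W = UNIV)"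

definition quandle_rep_equivalent ::
  "'q set \<Rightarrow> (complex \<Rightarrow> 'v \<Rightarrow> 'v) \<Rightarrow> ('q \<Rightarrow> 'v::ab_group_add \<Rightarrow> 'v) \<Rightarrow>
     (complex \<Rightarrow> 'w \<Rightarrow> 'w) \<Rightarrow> ('q \<Rightarrow> 'w::ab_group_add \<Rightarrow> 'w) \<Rightarrow> bool" where
  "quandle_rep_equivalent Q sV \<rho> sW \<rho>' \<longleftrightarrow>
     (\<exists>T \<in> lin_iso sV sW. \<forall>x\<in>Q. T \<circ> \<rho> x = \<rho>' x \<circ> T)"

definition rep_env ::
  "'q set \<Rightarrow> ('q \<Rightarrow> 'q \<Rightarrow> 'q) \<Rightarrow> (complex \<Rightarrow> 'v \<Rightarrow> 'v) \<Rightarrow> ('q \<Rightarrow> 'v::ab_group_add \<Rightarrow> 'v) \<Rightarrow>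
     (bool \<times> 'q) list set \<Rightarrow> 'v \<Rightarrow> 'v" where
  "rep_env Q qop sc \<rho> = env_lift Q qop (GL sc) \<rho>"

definition rep_Inn ::
  "'q set \<Rightarrow> ('q \<Rightarrow> 'q \<Rightarrow> 'q) \<Rightarrow> (complex \<Rightarrow> 'v \<Rightarrow> 'v) \<Rightarrow> ('q \<Rightarrow> 'v::ab_group_add \<Rightarrow> 'v) \<Rightarrow>
     (('q \<Rightarrow> 'q) \<Rightarrow> (bool \<times> 'q) list set) \<Rightarrow> ('q \<Rightarrow> 'q) \<Rightarrow> ('v \<Rightarrow> 'v) set" where
  "rep_Inn Q qop sc \<rho> s a = pgl_class sc (rep_env Q qop sc \<rho> (s a))"

section \<open>Well-definedness\<close>

lemma words_simps [simp]:
  "[] \<in> words X"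
  "(b, x) # u \<in> words X \<longleftrightarrow> x \<in> X \<and> u \<in> words X"
  "u @ v \<in> words X \<longleftrightarrow> u \<in> words X \<and> v \<in> words X"
  by (auto simp: words_def)

lemma word_cong_words: "word_cong X R u v \<Longrightarrow> u \<in> words X \<and> v \<in> words X"
  by (induction rule: word_cong.induct) auto

lemma equiv_word_rel: "equiv (words X) (word_rel X R)"
  by (rule equivI)
    (auto simp: word_rel_def refl_on_def sym_def trans_def dest: word_cong_words
      intro: word_cong.intros)

lemma word_rel_class_eq:
  "u \<in> words X \<Longrightarrow> v \<in> words X \<Longrightarrow>
     word_rel X R `` {u} = word_rel X R `` {v} \<longleftrightarrow> word_cong X R u v"
  using eq_equiv_class_iff[OF equiv_word_rel, of u X v R] by (simp add: word_rel_def)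

lemma presented_group_mult_class:
  assumes "u \<in> words X" "v \<in> words X"
  shows "word_rel X R `` {u} \<otimes>\<^bsub>presented_group X R\<^esub> word_rel X R `` {v} = word_rel X R `` {u @ v}"
proof -
  have eq: "word_rel X R `` {u' @ v'} = word_rel X R `` {u @ v}"
    if "u' \<in> word_rel X R `` {u}" "v' \<in> word_rel X R `` {v}" for u' v'
  proof -
    have c: "word_cong X R u u'" "word_cong X R v v'"
      using that by (auto simp: word_rel_def)
    then have "u' \<in> words X" "v' \<in> words X" by (auto dest: word_cong_words)
    then show ?thesis
      using assms word_sym[OF word_append[OF c]] by (simp add: word_rel_class_eq)
  qed
  have mem: "u \<in> word_rel X R `` {u}" "v \<in> word_rel X R `` {v}"
    using assms by (auto simp: word_rel_def intro: word_refl)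
  have "(\<Union>u'\<in>word_rel X R `` {u}. \<Union>v'\<in>word_rel X R `` {v}. word_rel X R `` {u' @ v'}) =
      (\<Union>u'\<in>word_rel X R `` {u}. \<Union>v'\<in>word_rel X R `` {v}. word_rel X R `` {u @ v})"
    by (intro SUP_cong refl eq)
  also have "\<dots> = word_rel X R `` {u @ v}"
    using mem by (metis UN_constant empty_iff)
  finally show ?thesis by (simp add: presented_group_def)
qed

lemma carrier_presented_groupE:
  assumes "A \<in> carrier (presented_group X R)"
  obtains u where "u \<in> words X" "A = word_rel X R `` {u}"
  using assms by (auto simp: presented_group_def elim: quotientE)

lemma class_in_carrier: "u \<in> words X \<Longrightarrow> word_rel X R `` {u} \<in> carrier (presented_group X R)"
  by (auto simp: presented_group_def intro: quotientI)

lemma presented_group_one: "\<one>\<^bsub>presented_group X R\<^esub> = word_rel X R `` {[]}"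
  by (simp add: presented_group_def)

lemma word_inverse:
  "u \<in> words X \<Longrightarrow> \<exists>v \<in> words X. word_cong X R (v @ u) []"
proof (induction u)
  case Nil
  then show ?case by (auto intro!: bexI[of _ "[]"] word_refl)
next
  case (Cons a u)
  obtain b x where a: "a = (b, x)" by (cases a)
  with Cons.prems have x: "x \<in> X" and u: "u \<in> words X" by auto
  then obtain v where v: "v \<in> words X" "word_cong X R (v @ u) []" using Cons.IH by blast
  have "word_cong X R ([(\<not> b, x), (b, x)] @ u) ([] @ u)"
    using word_cancel[OF x, of R "\<not> b"] u by (intro word_append word_refl) simp_all
  then have "word_cong X R (v @ ([(\<not> b, x), (b, x)] @ u)) (v @ ([] @ u))"
    by (rule word_append[OF word_refl[OF v(1)]])
  then have "word_cong X R ((v @ [(\<not> b, x)]) @ a # u) []"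
    using v(2) a by (auto intro: word_trans)
  then show ?case using v(1) x by (intro bexI[of _ "v @ [(\<not> b, x)]"]) auto
qed

lemma group_presented_group: "group (presented_group X R)"
proof (rule groupI)
  show "\<one>\<^bsub>presented_group X R\<^esub> \<in> carrier (presented_group X R)"
    by (simp add: presented_group_one class_in_carrier)
next
  fix A B assume "A \<in> carrier (presented_group X R)" "B \<in> carrier (presented_group X R)"
  then show "A \<otimes>\<^bsub>presented_group X R\<^esub> B \<in> carrier (presented_group X R)"
    by (elim carrier_presented_groupE) (simp add: presented_group_mult_class class_in_carrier)
next
  fix A B C assume "A \<in> carrier (presented_group X R)" "B \<in> carrier (presented_group X R)"
    "C \<in> carrier (presented_group X R)"
  then show "A \<otimes>\<^bsub>presented_group X R\<^esub> B \<otimes>\<^bsub>presented_group X R\<^esub> C =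
    A \<otimes>\<^bsub>presented_group X R\<^esub> (B \<otimes>\<^bsub>presented_group X R\<^esub> C)"
    by (elim carrier_presented_groupE) (simp add: presented_group_mult_class)
next
  fix A assume "A \<in> carrier (presented_group X R)"
  then show "\<one>\<^bsub>presented_group X R\<^esub> \<otimes>\<^bsub>presented_group X R\<^esub> A = A"
    by (elim carrier_presented_groupE) (simp add: presented_group_mult_class presented_group_one)
next
  fix A assume "A \<in> carrier (presented_group X R)"
  then obtain u where u: "u \<in> words X" "A = word_rel X R `` {u}"
    by (rule carrier_presented_groupE)
  then obtain v where v: "v \<in> words X" "word_cong X R (v @ u) []"
    using word_inverse by blast
  then have "word_rel X R `` {v} \<otimes>\<^bsub>presented_group X R\<^esub> A = \<one>\<^bsub>presented_group X R\<^esub>"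
    using u by (simp add: presented_group_mult_class presented_group_one word_rel_class_eq)
  then show "\<exists>B\<in>carrier (presented_group X R). B \<otimes>\<^bsub>presented_group X R\<^esub> A = \<one>\<^bsub>presented_group X R\<^esub>"
    using v(1) class_in_carrier by blast
qed

fun letter_val :: "('h, 'm) monoid_scheme \<Rightarrow> ('q \<Rightarrow> 'h) \<Rightarrow> bool \<times> 'q \<Rightarrow> 'h" where
  "letter_val H f (b, x) = (if b then f x else inv\<^bsub>H\<^esub> f x)"

definition word_val :: "('h, 'm) monoid_scheme \<Rightarrow> ('q \<Rightarrow> 'h) \<Rightarrow> (bool \<times> 'q) list \<Rightarrow> 'h" where
  "word_val H f u = foldr (\<lambda>a g. letter_val H f a \<otimes>\<^bsub>H\<^esub> g) u \<one>\<^bsub>H\<^esub>"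

lemma word_val_simps [simp]:
  "word_val H f [] = \<one>\<^bsub>H\<^esub>"
  "word_val H f (a # u) = letter_val H f a \<otimes>\<^bsub>H\<^esub> word_val H f u"
  by (simp_all add: word_val_def)

lemma presented_lift_ex1:
  assumes H: "group H" and f: "f \<in> X \<rightarrow> carrier H"
    and R: "\<And>u v. (u, v) \<in> R \<Longrightarrow> word_val H f u = word_val H f v"
  shows "\<exists>!h. h \<in> hom (presented_group X R) H \<and> h \<in> extensional (carrier (presented_group X R)) \<and>
    (\<forall>x\<in>X. h (word_rel X R `` {[(True, x)]}) = f x)"
proof -
  interpret H: group H by (rule H)
  interpret P: group "presented_group X R" by (rule group_presented_group)
  let ?P = "presented_group X R"
  have letter_closed: "letter_val H f (b, x) \<in> carrier H" if "x \<in> X" for b x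
    using f that by auto
  have closed: "word_val H f u \<in> carrier H" if "u \<in> words X" for u
    using that
  proof (induction u)
    case (Cons a u)
    then show ?case using letter_closed by (cases a) (simp del: letter_val.simps)
  qed simp
  have app: "word_val H f (u @ v) = word_val H f u \<otimes>\<^bsub>H\<^esub> word_val H f v"
    if "u \<in> words X" "v \<in> words X" for u v
    using that
  proof (induction u)
    case (Cons a u)
    then show ?case
      using letter_closed by (cases a) (simp del: letter_val.simps add: closed H.m_assoc)
  qed (simp add: closed)
  have cong: "word_val H f u = word_val H f v" if "word_cong X R u v" for u v
    using that
  proof (induction rule: word_cong.induct)
    case (word_append u u' v v')
    then show ?case by (metis app word_cong_words)
  next
    case (word_cancel x b)
    then have "f x \<in> carrier H" using f by auto
    then show ?case by (cases b) auto
  qed (use R in auto)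
  define h where "h = (\<lambda>A \<in> carrier ?P. word_val H f (SOME u. u \<in> A))"
  have h_class: "h (word_rel X R `` {u}) = word_val H f u" if u: "u \<in> words X" for u
  proof -
    have "u \<in> word_rel X R `` {u}" using u by (auto simp: word_rel_def intro: word_refl)
    then have "(SOME v. v \<in> word_rel X R `` {u}) \<in> word_rel X R `` {u}" by (rule someI)
    then have "word_cong X R u (SOME v. v \<in> word_rel X R `` {u})" by (simp add: word_rel_def)
    then show ?thesis using cong u by (simp add: h_def class_in_carrier)
  qed
  have "h \<in> hom ?P H"
  proof (rule homI)
    fix A assume "A \<in> carrier ?P"
    then show "h A \<in> carrier H" by (elim carrier_presented_groupE) (simp add: h_class closed)
  next
    fix A B assume "A \<in> carrier ?P" "B \<in> carrier ?P"
    then show "h (A \<otimes>\<^bsub>?P\<^esub> B) = h A \<otimes>\<^bsub>H\<^esub> h B"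
      by (elim carrier_presented_groupE) (simp add: presented_group_mult_class h_class app)
  qed
  moreover have h_ext: "h \<in> extensional (carrier ?P)" by (simp add: h_def)
  moreover have "\<forall>x\<in>X. h (word_rel X R `` {[(True, x)]}) = f x"
    using f by (auto simp: h_class Pi_iff)
  moreover have uniq: "k = h"
    if k: "k \<in> hom ?P H" "k \<in> extensional (carrier ?P)"
      "\<forall>x\<in>X. k (word_rel X R `` {[(True, x)]}) = f x" for k
  proof (rule extensionalityI[OF k(2) h_ext])
    interpret k: group_hom ?P H k by unfold_locales (rule k(1))
    have k_letter: "k (word_rel X R `` {[(b, x)]}) = letter_val H f (b, x)" if x: "x \<in> X" for b x
    proof (cases b)
      case True then show ?thesis using k(3) x by simp
    next
      case False
      let ?p = "word_rel X R `` {[(True, x)]}" and ?m = "word_rel X R `` {[(False, x)]}"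
      have "?m \<otimes>\<^bsub>?P\<^esub> ?p = \<one>\<^bsub>?P\<^esub>"
        using x word_cancel[OF x, of R False]
        by (simp add: presented_group_mult_class presented_group_one word_rel_class_eq)
      moreover have "?m \<in> carrier ?P" "?p \<in> carrier ?P" using x by (auto intro: class_in_carrier)
      ultimately have "?m = inv\<^bsub>?P\<^esub> ?p" by (metis P.inv_equality)
      then show ?thesis using \<open>?p \<in> carrier ?P\<close> k(3) x False by simp
    qed
    have k_class: "k (word_rel X R `` {u}) = word_val H f u" if "u \<in> words X" for u
      using that
    proof (induction u)
      case Nil
      then show ?case using k.hom_one by (simp add: presented_group_one)
    next
      case (Cons a u)
      obtain b x where a: "a = (b, x)" by (cases a)
      with Cons.prems have x: "x \<in> X" and u: "u \<in> words X" by auto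
      have "k (word_rel X R `` {a # u}) =
        k (word_rel X R `` {[(b, x)]} \<otimes>\<^bsub>?P\<^esub> word_rel X R `` {u})"
        using x u by (simp add: presented_group_mult_class a)
      also have "\<dots> = letter_val H f (b, x) \<otimes>\<^bsub>H\<^esub> word_val H f u"
        using x u Cons.IH k_letter by (simp add: class_in_carrier del: letter_val.simps)
      finally show ?case by (simp add: a)
    qed
    show "k A = h A" if "A \<in> carrier ?P" for A
      using that by (elim carrier_presented_groupE) (simp add: k_class h_class)
  qed
  ultimately show ?thesis
  proof (intro ex1I[of _ h] conjI)
    fix k assume "k \<in> hom ?P H \<and> k \<in> extensional (carrier ?P) \<and>
      (\<forall>x\<in>X. k (word_rel X R `` {[(True, x)]}) = f x)"
    then show "k = h" by (elim conjE) (rule uniq)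
  qed
qed

lemma env_lift_unique:
  assumes H: "group H" and f: "f \<in> Q \<rightarrow> carrier H"
    and rel: "\<And>x y. x \<in> Q \<Longrightarrow> y \<in> Q \<Longrightarrow> f (qop x y) = f x \<otimes>\<^bsub>H\<^esub> f y \<otimes>\<^bsub>H\<^esub> inv\<^bsub>H\<^esub> (f x)"
    and cl: "\<And>x y. x \<in> Q \<Longrightarrow> y \<in> Q \<Longrightarrow> qop x y \<in> Q"
  shows "\<exists>!h. h \<in> hom (env_group Q qop) H \<and> h \<in> extensional (carrier (env_group Q qop)) \<and>
    (\<forall>x\<in>Q. h (env_gen Q qop x) = f x)"
  unfolding env_group_def env_gen_def
proof (rule presented_lift_ex1[OF H f])
  interpret H: group H by (rule H)
  fix u v
  assume "(u, v) \<in> env_relators Q qop"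
  then obtain x y where xy: "x \<in> Q" "y \<in> Q"
    and uv: "u = [(True, x), (True, y), (False, x)]" "v = [(True, qop x y)]"
    by (auto simp: env_relators_def)
  then have "f x \<in> carrier H" "f y \<in> carrier H" "f (qop x y) \<in> carrier H" using f cl by auto
  then show "word_val H f u = word_val H f v" using rel[OF xy] by (simp add: uv H.m_assoc)
qed

lemma env_lift:
  assumes "group H" "f \<in> Q \<rightarrow> carrier H"
    and "\<And>x y. x \<in> Q \<Longrightarrow> y \<in> Q \<Longrightarrow> f (qop x y) = f x \<otimes>\<^bsub>H\<^esub> f y \<otimes>\<^bsub>H\<^esub> inv\<^bsub>H\<^esub> (f x)"
    and "\<And>x y. x \<in> Q \<Longrightarrow> y \<in> Q \<Longrightarrow> qop x y \<in> Q"
  shows "env_lift Q qop H f \<in> hom (env_group Q qop) H"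
    and "x \<in> Q \<Longrightarrow> env_lift Q qop H f (env_gen Q qop x) = f x"
proof -
  note * = theI'[OF env_lift_unique[OF assms], folded env_lift_def]
  show "env_lift Q qop H f \<in> hom (env_group Q qop) H" by (rule conjunct1[OF *])
  show "env_lift Q qop H f (env_gen Q qop x) = f x" if "x \<in> Q"
    by (rule bspec[OF conjunct2[OF conjunct2[OF *]] that])
qed

lemma group_GL:
  fixes sc :: "complex \<Rightarrow> 'v::ab_group_add \<Rightarrow> 'v"
  assumes "vector_space sc"
  shows "group (GL sc)"
proof -
  interpret vector_space sc by (rule assms)
  interpret vector_space_pair sc sc ..
  show ?thesis
  proof (rule groupI)
    show "\<one>\<^bsub>GL sc\<^esub> \<in> carrier (GL sc)" by (simp add: GL_def lin_iso_def linear_id)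
    show "f \<otimes>\<^bsub>GL sc\<^esub> g \<in> carrier (GL sc)" if "f \<in> carrier (GL sc)" "g \<in> carrier (GL sc)" for f g
      using that Vector_Spaces.linear_compose[of sc sc g sc f] bij_comp[of g f]
      by (simp add: GL_def lin_iso_def)
    show "\<exists>g\<in>carrier (GL sc). g \<otimes>\<^bsub>GL sc\<^esub> f = \<one>\<^bsub>GL sc\<^esub>" if "f \<in> carrier (GL sc)" for f
    proof (rule bexI[of _ "inv_into UNIV f"])
      have f: "Vector_Spaces.linear sc sc f" "bij f" using that by (auto simp: GL_def lin_iso_def)
      have r: "f (inv_into UNIV f v) = v" for v using f(2) by (simp add: bij_is_surj surj_f_inv_f)
      have l: "inv_into UNIV f (f v) = v" for v using f(2) by (simp add: bij_is_inj)
      interpret f: Vector_Spaces.linear sc sc f by (rule f(1))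
      have "Vector_Spaces.linear sc sc (inv_into UNIV f)"
      proof unfold_locales
        show "inv_into UNIV f (a + b) = inv_into UNIV f a + inv_into UNIV f b" for a b
          by (metis f.add l r)
        show "inv_into UNIV f (sc c a) = sc c (inv_into UNIV f a)" for c a
          by (metis f.scale l r)
      qed
      then show "inv_into UNIV f \<in> carrier (GL sc)"
        using f(2) by (simp add: GL_def lin_iso_def bij_imp_bij_inv)
      show "inv_into UNIV f \<otimes>\<^bsub>GL sc\<^esub> f = \<one>\<^bsub>GL sc\<^esub>" by (simp add: GL_def l fun_eq_iff)
    qed
  qed (simp_all add: GL_def o_assoc)
qed

lemma rep_env:
  assumes "quandle Q qop" "quandle_rep Q qop sc \<rho>"
  shows "rep_env Q qop sc \<rho> \<in> hom (env_group Q qop) (GL sc)"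
    and "x \<in> Q \<Longrightarrow> rep_env Q qop sc \<rho> (env_gen Q qop x) = \<rho> x"
proof -
  have G: "group (GL sc)" and car: "\<rho> \<in> Q \<rightarrow> carrier (GL sc)"
    and rel: "\<And>x y. x \<in> Q \<Longrightarrow> y \<in> Q \<Longrightarrow>
      \<rho> (qop x y) = \<rho> x \<otimes>\<^bsub>GL sc\<^esub> \<rho> y \<otimes>\<^bsub>GL sc\<^esub> inv\<^bsub>GL sc\<^esub> (\<rho> x)"
    using assms(2) group_GL[of sc] by (simp_all add: quandle_rep_def)
  show "rep_env Q qop sc \<rho> \<in> hom (env_group Q qop) (GL sc)"
    unfolding rep_env_def by (rule env_lift(1)) (fact G car rel quandle.closed[OF assms(1)])+
  show "rep_env Q qop sc \<rho> (env_gen Q qop x) = \<rho> x" if "x \<in> Q"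
    unfolding rep_env_def by (rule env_lift(2)) (fact G car rel quandle.closed[OF assms(1)] that)+
qed

lemma scalars_normal:
  fixes sc :: "complex \<Rightarrow> 'v::ab_group_add \<Rightarrow> 'v"
  assumes "vector_space sc"
  shows "scalars sc \<lhd> GL sc"
proof -
  interpret vector_space sc by (rule assms)
  interpret G: group "GL sc" using assms by (rule group_GL)
  have carr: "sc c \<in> carrier (GL sc)" if c: "c \<noteq> 0" for c
  proof -
    have "bij (sc c)" by (rule o_bij[of "sc (inverse c)"]) (use c in \<open>auto simp: fun_eq_iff\<close>)
    moreover have "Vector_Spaces.linear sc sc (sc c)"
      by unfold_locales (auto simp: scale_right_distrib mult.commute)
    ultimately show ?thesis by (simp add: GL_def lin_iso_def)
  qed
  have mult: "sc c \<otimes>\<^bsub>GL sc\<^esub> sc d = sc (c * d)" for c d by (auto simp: GL_def fun_eq_iff)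
  have one: "\<one>\<^bsub>GL sc\<^esub> = sc 1" by (auto simp: GL_def fun_eq_iff)
  have inv: "inv\<^bsub>GL sc\<^esub> (sc c) = sc (inverse c)" if "c \<noteq> 0" for c
    by (rule G.inv_equality) (use that carr in \<open>auto simp: mult one\<close>)
  have "subgroup (scalars sc) (GL sc)"
    by (rule G.subgroupI) (use carr in \<open>auto simp: scalars_def inv mult intro: exI[of _ 1]\<close>)
  moreover have "f \<otimes>\<^bsub>GL sc\<^esub> g \<otimes>\<^bsub>GL sc\<^esub> inv\<^bsub>GL sc\<^esub> f \<in> scalars sc"
    if f: "f \<in> carrier (GL sc)" and g: "g \<in> scalars sc" for f g
  proof -
    obtain c where c: "g = sc c" "c \<noteq> 0" using g by (auto simp: scalars_def)
    interpret f: Vector_Spaces.linear sc sc f using f by (simp add: GL_def lin_iso_def)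
    have "f \<otimes>\<^bsub>GL sc\<^esub> g = g \<otimes>\<^bsub>GL sc\<^esub> f" by (auto simp: GL_def c f.scale fun_eq_iff)
    then have "f \<otimes>\<^bsub>GL sc\<^esub> g \<otimes>\<^bsub>GL sc\<^esub> inv\<^bsub>GL sc\<^esub> f = g"
      using f c carr by (simp add: G.m_assoc)
    then show ?thesis using g by simp
  qed
  ultimately show ?thesis by (simp add: G.normal_inv_iff)
qed

lemma group_PGL: "vector_space sc \<Longrightarrow> group (PGL sc)"
  unfolding PGL_def by (intro normal.factorgroup_is_group scalars_normal)

context quandle
begin

lemma left_trans_Bij: "x \<in> Q \<Longrightarrow> left_trans Q (\<rhd>) x \<in> carrier (BijGroup Q)"
proof -
  assume x: "x \<in> Q"
  have "bij_betw (\<lambda>y. x \<rhd> y) Q Q"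
    unfolding bij_betw_def
  proof
    show "inj_on (\<lambda>y. x \<rhd> y) Q"
      using left_div[OF x closed[OF x]] by (intro inj_onI) metis
    show "(\<lambda>y. x \<rhd> y) ` Q = Q"
    proof
      show "(\<lambda>y. x \<rhd> y) ` Q \<subseteq> Q" using closed[OF x] by blast
      show "Q \<subseteq> (\<lambda>y. x \<rhd> y) ` Q" using left_div[OF x] by (metis image_eqI subsetI)
    qed
  qed
  then show ?thesis by (simp add: left_trans_def BijGroup_def Bij_def)
qed

lemma group_Inn: "group (Inn Q (\<rhd>))"
  unfolding Inn_def by (intro group.group_subgroup_generated group_BijGroup)

lemma left_trans_Inn: "x \<in> Q \<Longrightarrow> left_trans Q (\<rhd>) x \<in> carrier (Inn Q (\<rhd>))"
  unfolding Inn_def carrier_subgroup_generated by (auto intro: generate.incl left_trans_Bij)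

lemma left_trans_conj:
  assumes x: "x \<in> Q" and y: "y \<in> Q"
  shows "left_trans Q (\<rhd>) (x \<rhd> y) =
    left_trans Q (\<rhd>) x \<otimes>\<^bsub>Inn Q (\<rhd>)\<^esub> left_trans Q (\<rhd>) y \<otimes>\<^bsub>Inn Q (\<rhd>)\<^esub>
      inv\<^bsub>Inn Q (\<rhd>)\<^esub> (left_trans Q (\<rhd>) x)"
proof -
  interpret I: group "Inn Q (\<rhd>)" by (rule group_Inn)
  have mult: "left_trans Q (\<rhd>) u \<otimes>\<^bsub>Inn Q (\<rhd>)\<^esub> left_trans Q (\<rhd>) v = (\<lambda>z\<in>Q. u \<rhd> (v \<rhd> z))"
    if "u \<in> Q" "v \<in> Q" for u v
    using left_trans_Bij[OF that(1)] left_trans_Bij[OF that(2)] that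
    by (auto simp: Inn_def BijGroup_def compose_def left_trans_def fun_eq_iff closed)
  have "left_trans Q (\<rhd>) (x \<rhd> y) \<otimes>\<^bsub>Inn Q (\<rhd>)\<^esub> left_trans Q (\<rhd>) x =
    left_trans Q (\<rhd>) x \<otimes>\<^bsub>Inn Q (\<rhd>)\<^esub> left_trans Q (\<rhd>) y"
    using x y by (simp add: mult closed distrib[OF x y, symmetric] cong: restrict_cong)
  then show ?thesis
    using x y by (metis I.inv_solve_right I.m_closed closed left_trans_Inn)
qed

lemma env_theta:
  shows "env_theta Q (\<rhd>) \<in> hom (env_group Q (\<rhd>)) (Inn Q (\<rhd>))"
    and "x \<in> Q \<Longrightarrow> env_theta Q (\<rhd>) (env_gen Q (\<rhd>) x) = left_trans Q (\<rhd>) x"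
proof -
  have car: "left_trans Q (\<rhd>) \<in> Q \<rightarrow> carrier (Inn Q (\<rhd>))" using left_trans_Inn by blast
  show "env_theta Q (\<rhd>) \<in> hom (env_group Q (\<rhd>)) (Inn Q (\<rhd>))"
    unfolding env_theta_def by (rule env_lift(1)) (fact group_Inn car left_trans_conj closed)+
  show "env_theta Q (\<rhd>) (env_gen Q (\<rhd>) x) = left_trans Q (\<rhd>) x" if "x \<in> Q"
    unfolding env_theta_def
    by (rule env_lift(2)) (fact group_Inn car left_trans_conj closed that)+
qed

end

end

theory Submission
  imports Defs "HOL-Computational_Algebra.Fundamental_Theorem_Algebra"
    "HOL-Analysis.Continuum_Not_Denumerable"
begin

text \<open>
  Everything rests on one fact: an element \<open>z\<close> of the kernel of \<open>\<theta>\<close> acts on \<open>V\<close> as a nonzero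
  scalar. If \<open>g\<close> and \<open>h\<close> have the same image in the inner group, then \<open>g h\<^sup>-\<^sup>1\<close> lies in
  the kernel, so \<open>g\<close> and \<open>h\<close> act by the same class in \<open>PGL(V)\<close> (\<open>pgl_class_cong\<close>). Hence the
  projective representation is multiplicative, does not depend on the section and, since the
  section at \<open>L\<^sub>x\<close> may be replaced by the generator \<open>x\<close>, takes the class of \<open>\<rho>(x)\<close> at \<open>L\<^sub>x\<close>. It is
  irreducible because a projective subspace that is stable under the classes of all \<open>\<rho>(x)\<close>
  comes from a linear subspace that is stable under all \<open>\<rho>(x)\<close>. A linear equivalence intertwines
  the two representations of the enveloping group, and so its class is a projective equivalence.

  For the scalar action, the identity \<open>g y g\<^sup>-\<^sup>1 = \<theta>(g)(y)\<close> for generators \<open>y\<close> (\<open>env_conj\<close>)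
  shows that \<open>z\<close> commutes with all generators, and a form of Schur's lemma applies. Instead
  of showing first that \<open>V\<close> is finite dimensional, the argument of Dixmier is used. The
  enveloping group of a finite quandle is countable, so that \<open>V\<close>, the span of an orbit, has
  countable dimension. If \<open>T - r\<close> were bijective for every complex \<open>r\<close>, then for \<open>v \<noteq> 0\<close> the
  vectors \<open>(T - r)\<^sup>-\<^sup>1 v\<close> would form an uncountable independent family. So some \<open>T - r\<close> is not
  bijective, and if \<open>T\<close> commutes with an irreducible family of operators then the kernel and the
  image of \<open>T - r\<close> are invariant, which forces \<open>T = r\<close> (\<open>schur_countable\<close>).
\<close>

section \<open>Operators on complex vector spaces of countable dimension\<close>

lemma (in vector_space) countable_independent:
  assumes S: "countable S" and B: "independent B" "B \<subseteq> span S"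
  shows "countable B"
proof -
  have "finite (B \<inter> span F)" if "finite F" for F
    using independent_span_bound[OF that, of "B \<inter> span F"] independent_mono[OF B(1)] by blast
  then have "countable (\<Union>F\<in>{F. finite F \<and> F \<subseteq> S}. B \<inter> span F)"
    using countable_Collect_finite_subset[OF S] by (intro countable_UN) (auto intro: countable_finite)
  moreover have "B \<subseteq> (\<Union>F\<in>{F. finite F \<and> F \<subseteq> S}. B \<inter> span F)"
  proof
    fix b assume b: "b \<in> B"
    then obtain F r where "finite F" "F \<subseteq> S" "b = (\<Sum>a\<in>F. scale (r a) a)"
      using B(2) unfolding span_explicit by blast
    moreover have "(\<Sum>a\<in>F. scale (r a) a) \<in> span F"
      by (intro span_sum span_scale span_base)
    ultimately show "b \<in> (\<Union>F\<in>{F. finite F \<and> F \<subseteq> S}. B \<inter> span F)" using b by blast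
  qed
  ultimately show ?thesis by (rule countable_subset[rotated])
qed

text \<open>
  The vector \<open>p(T) v\<close> for a polynomial \<open>p\<close> and a linear operator \<open>T\<close>, computed by Horner's
  scheme; \<open>sc\<close> is the scalar multiplication.
\<close>

definition poly_op ::
  "('a::field \<Rightarrow> 'v::ab_group_add \<Rightarrow> 'v) \<Rightarrow> ('v \<Rightarrow> 'v) \<Rightarrow> 'a poly \<Rightarrow> 'v \<Rightarrow> 'v" where
  "poly_op sc T p v = fold_coeffs (\<lambda>a w. sc a v + T w) p 0"

context
  fixes sc :: "'a::field \<Rightarrow> 'v::ab_group_add \<Rightarrow> 'v" and T :: "'v \<Rightarrow> 'v"
  assumes T: "Vector_Spaces.linear sc sc T"
begin

interpretation T: Vector_Spaces.linear sc sc T by (rule T)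

lemma poly_op_0: "poly_op sc T 0 v = 0"
  by (simp add: poly_op_def)

lemma poly_op_pCons: "poly_op sc T (pCons a p) v = sc a v + T (poly_op sc T p v)"
  by (cases "p = 0 \<and> a = 0") (auto simp: poly_op_def T.zero)

lemma poly_op_add: "poly_op sc T (p + q) v = poly_op sc T p v + poly_op sc T q v"
  by (induction p q rule: poly_induct2)
    (simp_all add: poly_op_0 poly_op_pCons T.add T.vs1.scale_left_distrib)

lemma poly_op_smult: "poly_op sc T (smult c p) v = sc c (poly_op sc T p v)"
  by (induction p)
    (simp_all add: poly_op_0 poly_op_pCons T.scale T.vs1.scale_right_distrib)

lemma poly_op_mult: "poly_op sc T (p * q) v = poly_op sc T p (poly_op sc T q v)"
  by (induction p) (simp_all add: poly_op_0 poly_op_pCons poly_op_add poly_op_smult)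

lemma poly_op_sum: "poly_op sc T (\<Sum>i\<in>I. p i) v = (\<Sum>i\<in>I. poly_op sc T (p i) v)"
  by (induction I rule: infinite_finite_induct) (simp_all add: poly_op_0 poly_op_add)

lemma poly_op_linear: "Vector_Spaces.linear sc sc (poly_op sc T p)"
proof (induction p)
  case 0
  show ?case by unfold_locales (simp_all add: poly_op_0)
next
  case (pCons a p)
  interpret p: Vector_Spaces.linear sc sc "poly_op sc T p" by (rule pCons.IH)
  show ?case
    by unfold_locales
      (simp_all add: poly_op_pCons T.add T.scale p.add p.scale T.vs1.scale_right_distrib mult.commute)
qed

end

text \<open>
  For a nonzero complex polynomial \<open>p\<close>, the operator \<open>p(T)\<close> is a nonzero multiple of a product
  of operators \<open>T - r\<close>, and all of these are injective when \<open>T\<close> has no eigenvector.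
\<close>

lemma poly_op_nonzero:
  fixes sc :: "complex \<Rightarrow> 'v::ab_group_add \<Rightarrow> 'v"
  assumes T: "Vector_Spaces.linear sc sc T"
    and no_eig: "\<forall>r v. T v = sc r v \<longrightarrow> v = 0"
    and "p \<noteq> 0" "v \<noteq> 0"
  shows "poly_op sc T p v \<noteq> 0"
  using \<open>p \<noteq> 0\<close>
proof (induction "degree p" arbitrary: p)
  case 0
  interpret T: Vector_Spaces.linear sc sc T by (rule T)
  from 0 obtain a where "p = [:a:]" "a \<noteq> 0" by (metis degree_0_id pCons_0_0)
  then show ?case using \<open>v \<noteq> 0\<close> by (simp add: poly_op_pCons[OF T] poly_op_0[OF T] T.zero)
next
  case (Suc n)
  interpret T: Vector_Spaces.linear sc sc T by (rule T)
  from Suc obtain r where "poly p r = 0"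
    by (metis constant_degree fundamental_theorem_of_algebra nat.distinct(1))
  then obtain q where q: "p = [:- r, 1:] * q" by (metis dvdE poly_eq_0_iff_dvd)
  with Suc have "q \<noteq> 0" by auto
  moreover have "degree q = n"
  proof -
    have "degree p = degree [:- r, 1:] + degree q"
      unfolding q using \<open>q \<noteq> 0\<close> by (intro degree_mult_eq) auto
    then show ?thesis using Suc.hyps(2) by simp
  qed
  ultimately have "poly_op sc T q v \<noteq> 0" using Suc.hyps(1) by simp
  moreover have "poly_op sc T p v = T (poly_op sc T q v) - sc r (poly_op sc T q v)"
    unfolding q
    by (simp add: poly_op_mult[OF T] poly_op_pCons[OF T] poly_op_0[OF T] T.zero del: mult_pCons_left)
  ultimately show ?case using no_eig by auto
qed

text \<open>
  The resolvent vectors \<open>(T - r)\<^sup>-\<^sup>1 v\<close> are linearly independent when \<open>T\<close> has no eigenvector: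
  clearing denominators turns a linear relation among them into \<open>q(T) v = 0\<close> for a polynomial \<open>q\<close>.
\<close>

lemma resolvent_relation_trivial:
  fixes sc :: "complex \<Rightarrow> 'v::ab_group_add \<Rightarrow> 'v"
  assumes T: "Vector_Spaces.linear sc sc T"
    and no_eig: "\<forall>r v. T v = sc r v \<longrightarrow> v = 0"
    and "v \<noteq> 0" and F: "finite F"
    and w: "\<And>r. r \<in> F \<Longrightarrow> T (w r) - sc r (w r) = v"
    and rel: "(\<Sum>r\<in>F. sc (c r) (w r)) = 0" and r: "r \<in> F"
  shows "c r = 0"
proof -
  interpret T: Vector_Spaces.linear sc sc T by (rule T)
  \<comment> \<open>\<open>P(F)\<close> is the common denominator of the resolvents, and \<open>q\<close> the resulting numerator.\<close>
  define P where "P A = (\<Prod>m\<in>A. [:- m, 1:])" for A :: "complex set"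
  define q where "q = (\<Sum>m\<in>F. smult (c m) (P (F - {m})))"
  interpret PF: Vector_Spaces.linear sc sc "poly_op sc T (P F)" by (rule poly_op_linear[OF T])
  have step: "poly_op sc T (P F) (w m) = poly_op sc T (P (F - {m})) v" if "m \<in> F" for m
  proof -
    have "P F = P (F - {m}) * [:- m, 1:]"
      unfolding P_def using prod.remove[OF F that, of "\<lambda>m. [:- m, 1:]"] by (simp only: mult.commute)
    moreover have "poly_op sc T [:- m, 1:] (w m) = v"
      using w[OF that] by (simp add: poly_op_pCons[OF T] poly_op_0[OF T] T.zero)
    ultimately show ?thesis by (simp only: poly_op_mult[OF T])
  qed
  have "poly_op sc T q v = (\<Sum>m\<in>F. sc (c m) (poly_op sc T (P F) (w m)))"
    by (simp add: q_def poly_op_sum[OF T] poly_op_smult[OF T] step)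
  also have "\<dots> = poly_op sc T (P F) (\<Sum>m\<in>F. sc (c m) (w m))"
    by (simp add: PF.sum PF.scale)
  also have "\<dots> = 0" by (simp add: rel PF.zero)
  finally have "q = 0" using poly_op_nonzero[of sc T q v, OF T no_eig] \<open>v \<noteq> 0\<close> by blast
  \<comment> \<open>At \<open>r\<close> only the summand of \<open>q\<close> belonging to \<open>r\<close> survives.\<close>
  then have "0 = poly q r" by simp
  also have "\<dots> = (\<Sum>m\<in>F. c m * (\<Prod>k\<in>F - {m}. r - k))"
    by (simp add: q_def P_def poly_sum poly_prod)
  also have "\<dots> = c r * (\<Prod>k\<in>F - {r}. r - k)"
    using F r by (subst sum.remove[OF F r]) (auto intro!: sum.neutral prod_zero)
  finally show ?thesis using F by (auto simp: prod_zero_iff)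
qed

text \<open>
  An operator on a nonzero space of countable dimension has nonempty spectrum: otherwise the
  resolvent vectors of a fixed nonzero vector would form an uncountable independent set.
\<close>

lemma ex_not_bij_operator:
  fixes sc :: "complex \<Rightarrow> 'v::ab_group_add \<Rightarrow> 'v"
  assumes T: "Vector_Spaces.linear sc sc T"
    and S: "countable S" "module.span sc S = UNIV" and ne: "(UNIV :: 'v set) \<noteq> {0}"
  shows "\<exists>r. \<not> bij (\<lambda>v. T v - sc r v)"
proof (rule ccontr)
  assume "\<not> ?thesis"
  then have bij: "bij (\<lambda>v. T v - sc r v)" for r by blast
  interpret T: Vector_Spaces.linear sc sc T by (rule T)
  have no_eig: "\<forall>r u. T u = sc r u \<longrightarrow> u = 0"
  proof clarify
    fix r u assume "T u = sc r u"
    then show "u = 0" using injD[OF bij_is_inj[OF bij[of r]], of u 0] by (simp add: T.zero)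
  qed
  obtain v :: 'v where v: "v \<noteq> 0" using ne by auto
  define w where "w r = inv_into UNIV (\<lambda>u. T u - sc r u) v" for r
  have w: "T (w r) - sc r (w r) = v" for r
    using surj_f_inv_f[OF bij_is_surj[OF bij[of r]], of v] by (simp add: w_def)
  have inj: "inj w"
  proof (rule injI)
    fix r m assume eq: "w r = w m"
    have "sc (r - m) (w r) = 0"
    proof -
      have "T (w m) - sc r (w m) = T (w m) - sc m (w m)" using w[of r] w[of m] eq by simp
      then show ?thesis by (simp add: eq T.vs1.scale_left_diff_distrib)
    qed
    moreover have "w r \<noteq> 0" using w[of r] v by (auto simp: T.zero)
    ultimately show "r = m" by simp
  qed
  have "T.vs1.independent (range w)"
    unfolding T.vs1.dependent_explicit
  proof clarify
    fix t u x
    assume t: "finite t" "t \<subseteq> range w" "(\<Sum>v\<in>t. sc (u v) v) = 0" and x: "x \<in> t" "u x \<noteq> 0"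
    obtain F where F: "t = w ` F" using t(2) by (metis subset_imageE)
    have injF: "inj_on w F" using inj by (rule inj_on_subset) simp
    have "finite F" using t(1) F injF by (simp add: finite_image_iff)
    moreover have "(\<Sum>r\<in>F. sc (u (w r)) (w r)) = 0"
      using t(3) injF by (simp add: F sum.reindex)
    moreover obtain r where "r \<in> F" "x = w r" using x F by auto
    ultimately have "u (w r) = 0"
      using resolvent_relation_trivial[of sc T v F w "\<lambda>r. u (w r)", OF T no_eig v] w by blast
    then show False using x \<open>x = w r\<close> by simp
  qed
  then have "countable (range w)" using T.vs1.countable_independent[OF S(1)] S(2) by blast
  then have "countable (UNIV :: complex set)" using inj by (rule countable_image_inj_on)
  then have "countable (range complex_of_real)" by (rule countable_subset[rotated]) simp
  then have "countable (UNIV :: real set)"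
    by (rule countable_image_inj_on) (simp add: inj_on_def)
  then show False using uncountable_UNIV_real by simp
qed

text \<open>
  Schur's lemma in countable dimension (Dixmier): an operator that commutes with an irreducible
  set \<open>A\<close> of operators is a scalar.
\<close>

lemma schur_countable:
  fixes sc :: "complex \<Rightarrow> 'v::ab_group_add \<Rightarrow> 'v"
  assumes T: "Vector_Spaces.linear sc sc T"
    and S: "countable S" "module.span sc S = UNIV" and ne: "(UNIV :: 'v set) \<noteq> {0}"
    and A: "\<And>f. f \<in> A \<Longrightarrow> Vector_Spaces.linear sc sc f" "\<And>f v. f \<in> A \<Longrightarrow> f (T v) = T (f v)"
    and irr: "\<And>W. module.subspace sc W \<Longrightarrow> (\<And>f. f \<in> A \<Longrightarrow> f ` W \<subseteq> W) \<Longrightarrow> W = {0} \<or> W = UNIV"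
  shows "\<exists>r. T = sc r"
proof -
  interpret T: Vector_Spaces.linear sc sc T by (rule T)
  obtain r where r: "\<not> bij (\<lambda>v. T v - sc r v)" using ex_not_bij_operator[OF T S ne] by blast
  define D where "D v = T v - sc r v" for v
  have comm: "f (D v) = D (f v)" if "f \<in> A" for f v
  proof -
    interpret f: Vector_Spaces.linear sc sc f by (rule A(1)[OF that])
    show ?thesis by (simp add: D_def f.diff f.scale A(2)[OF that])
  qed
  have D: "Vector_Spaces.linear sc sc D"
    unfolding D_def by unfold_locales
      (simp_all add: T.add T.scale T.vs1.scale_right_distrib T.vs1.scale_right_diff_distrib mult.commute)
  interpret D: Vector_Spaces.linear sc sc D by (rule D)
  have "{v. D v = 0} = {0} \<or> {v. D v = 0} = UNIV"
  proof (rule irr)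
    show "T.vs1.subspace {v. D v = 0}" by (rule D.subspace_kernel)
    fix f assume f: "f \<in> A"
    interpret f: Vector_Spaces.linear sc sc f by (rule A(1)[OF f])
    show "f ` {v. D v = 0} \<subseteq> {v. D v = 0}" 
    proof clarify
      fix v assume "D v = 0"
      then show "D (f v) = 0" using comm[OF f, of v] f.zero by simp
    qed
  qed
  moreover have "range D = {0} \<or> range D = UNIV"
  proof (rule irr)
    show "T.vs1.subspace (range D)" using T.vs1.subspace_UNIV by (rule D.subspace_image)
    show "f ` range D \<subseteq> range D" if "f \<in> A" for f using comm[OF that] by auto
  qed
  moreover have "\<not> (inj D \<and> range D = UNIV)" using r unfolding D_def by (simp add: bij_def)
  ultimately have "D v = 0" for v unfolding D.inj_iff_eq_0 by blast
  then have "T = sc r" by (simp add: D_def fun_eq_iff)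
  then show ?thesis ..
qed

section \<open>The enveloping group\<close>

lemma group_env_group: "group (env_group Q qop)"
  unfolding env_group_def by (rule group_presented_group)

lemma env_gen_closed: "x \<in> Q \<Longrightarrow> env_gen Q qop x \<in> carrier (env_group Q qop)"
  unfolding env_gen_def env_group_def by (rule class_in_carrier) simp

lemma env_group_generate:
  "carrier (env_group Q qop) \<subseteq> generate (env_group Q qop) (env_gen Q qop ` Q)"
proof
  let ?R = "env_relators Q qop" and ?P = "env_group Q qop"
  interpret P: group ?P by (rule group_env_group)
  fix g assume "g \<in> carrier ?P"
  then obtain u where u: "u \<in> words Q" and g: "g = word_rel Q ?R `` {u}"
    unfolding env_group_def by (rule carrier_presented_groupE)
  have letter: "word_rel Q ?R `` {[(b, x)]} \<in> generate ?P (env_gen Q qop ` Q)" if x: "x \<in> Q" for b x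
  proof (cases b)
    case True
    then show ?thesis using x by (auto simp: env_gen_def[symmetric] intro: generate.incl)
  next
    case False
    have "word_rel Q ?R `` {[(False, x)]} \<otimes>\<^bsub>?P\<^esub> env_gen Q qop x = \<one>\<^bsub>?P\<^esub>"
      using x word_cancel[OF x, of ?R False]
      by (simp add: env_group_def env_gen_def presented_group_mult_class presented_group_one
          word_rel_class_eq)
    moreover have "word_rel Q ?R `` {[(False, x)]} \<in> carrier ?P"
      unfolding env_group_def using x by (auto intro: class_in_carrier)
    ultimately have "word_rel Q ?R `` {[(False, x)]} = inv\<^bsub>?P\<^esub> (env_gen Q qop x)"
      using env_gen_closed[OF x] by (metis P.inv_equality)
    then show ?thesis using x False by (auto intro: generate.inv)
  qed
  have "word_rel Q ?R `` {u} \<in> generate ?P (env_gen Q qop ` Q)"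
    using u
  proof (induction u)
    case Nil
    have "word_rel Q ?R `` {[]} = \<one>\<^bsub>?P\<^esub>" by (simp add: env_group_def presented_group_one)
    then show ?case by (simp add: generate.one)
  next
    case (Cons a u)
    obtain b x where a: "a = (b, x)" by (cases a)
    with Cons.prems have x: "x \<in> Q" and u: "u \<in> words Q" by auto
    have "word_rel Q ?R `` {a # u} = word_rel Q ?R `` {[(b, x)]} \<otimes>\<^bsub>?P\<^esub> word_rel Q ?R `` {u}"
      using x u by (simp add: env_group_def presented_group_mult_class a)
    then show ?case using letter[OF x] Cons.IH[OF u] by (simp add: generate.eng)
  qed
  then show "g \<in> generate ?P (env_gen Q qop ` Q)" by (simp add: g)
qed

lemma env_group_induct [consumes 1, case_names one gen inv_gen mult]:
  assumes "g \<in> carrier (env_group Q qop)"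
    and "P \<one>\<^bsub>env_group Q qop\<^esub>"
    and "\<And>x. x \<in> Q \<Longrightarrow> P (env_gen Q qop x)"
    and "\<And>x. x \<in> Q \<Longrightarrow> P (inv\<^bsub>env_group Q qop\<^esub> (env_gen Q qop x))"
    and "\<And>g h. g \<in> carrier (env_group Q qop) \<Longrightarrow> h \<in> carrier (env_group Q qop) \<Longrightarrow>
      P g \<Longrightarrow> P h \<Longrightarrow> P (g \<otimes>\<^bsub>env_group Q qop\<^esub> h)"
  shows "P g"
proof -
  interpret G: group "env_group Q qop" by (rule group_env_group)
  have sub: "env_gen Q qop ` Q \<subseteq> carrier (env_group Q qop)"
    by (rule image_subsetI) (rule env_gen_closed)
  have "g \<in> generate (env_group Q qop) (env_gen Q qop ` Q)"
    by (rule subsetD[OF env_group_generate assms(1)])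
  then show ?thesis
  proof induction
    case one
    show ?case by (rule assms(2))
  next
    case (incl h)
    then show ?case using assms(3) by blast
  next
    case (inv h)
    then show ?case using assms(4) by blast
  next
    case (eng h1 h2)
    show ?case
      by (rule assms(5)) (fact G.generate_in_carrier[OF sub eng.hyps(1)]
          G.generate_in_carrier[OF sub eng.hyps(2)] eng.IH)+
  qed
qed

lemma countable_env_group:
  assumes "finite Q"
  shows "countable (carrier (env_group Q qop))"
proof -
  have "countable (words Q)"
    unfolding words_def using assms by (intro countable_lists countable_finite) simp
  moreover have "carrier (env_group Q qop) \<subseteq> (\<lambda>u. word_rel Q (env_relators Q qop) `` {u}) ` words Q"
    unfolding env_group_def by (auto elim: carrier_presented_groupE)
  ultimately show ?thesis by (meson countable_image countable_subset)
qed

context quandle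
begin

lemma Inn_closed: "a \<in> carrier (Inn Q (\<rhd>)) \<Longrightarrow> y \<in> Q \<Longrightarrow> a y \<in> Q"
proof -
  assume a: "a \<in> carrier (Inn Q (\<rhd>))" and y: "y \<in> Q"
  have "a \<in> carrier (BijGroup Q)"
    using a group.carrier_subgroup_generated_subset[OF group_BijGroup] unfolding Inn_def by blast
  then show ?thesis using y by (auto simp: BijGroup_def Bij_def bij_betw_def)
qed

lemma Inn_mult_apply:
  assumes "a \<in> carrier (Inn Q (\<rhd>))" "b \<in> carrier (Inn Q (\<rhd>))" "y \<in> Q"
  shows "(a \<otimes>\<^bsub>Inn Q (\<rhd>)\<^esub> b) y = a (b y)"
proof -
  have "a \<in> carrier (BijGroup Q)" "b \<in> carrier (BijGroup Q)"
    using assms group.carrier_subgroup_generated_subset[OF group_BijGroup] unfolding Inn_def by blast+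
  then show ?thesis using assms(3) by (simp add: Inn_def BijGroup_def compose_def)
qed

lemma Inn_one_apply: "y \<in> Q \<Longrightarrow> \<one>\<^bsub>Inn Q (\<rhd>)\<^esub> y = y"
  by (simp add: Inn_def BijGroup_def)

text \<open>The defining relation of the enveloping group, in the form \<open>x y = (x \<rhd> y) x\<close>.\<close>

lemma env_gen_conj:
  assumes x: "x \<in> Q" and y: "y \<in> Q"
  shows "env_gen Q (\<rhd>) x \<otimes>\<^bsub>env_group Q (\<rhd>)\<^esub> env_gen Q (\<rhd>) y =
    env_gen Q (\<rhd>) (x \<rhd> y) \<otimes>\<^bsub>env_group Q (\<rhd>)\<^esub> env_gen Q (\<rhd>) x"
proof -
  let ?R = "env_relators Q (\<rhd>)"
  have "word_cong Q ?R [(True, x), (True, y), (False, x)] [(True, x \<rhd> y)]"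
    using x y closed by (intro word_relator) (auto simp: env_relators_def)
  then have "word_cong Q ?R ([(True, x), (True, y), (False, x)] @ [(True, x)]) ([(True, x \<rhd> y)] @ [(True, x)])"
    using x by (intro word_append word_refl) auto
  moreover have "word_cong Q ?R ([(True, x), (True, y)] @ [(False, x), (True, x)]) ([(True, x), (True, y)] @ [])"
    using x y word_cancel[OF x, of ?R False] by (intro word_append word_refl) auto
  ultimately have "word_cong Q ?R [(True, x), (True, y)] [(True, x \<rhd> y), (True, x)]"
    by (auto intro: word_trans word_sym)
  then show ?thesis
    using x y closed
    by (simp add: env_gen_def env_group_def presented_group_mult_class word_rel_class_eq)
qed

text \<open>
  The conjugation action of the enveloping group permutes the generators in the way in which the
  inner group permutes \<open>Q\<close>; in particular the kernel of \<open>\<theta>\<close> is central.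
\<close>

lemma env_conj:
  assumes "g \<in> carrier (env_group Q (\<rhd>))" "y \<in> Q"
  shows "g \<otimes>\<^bsub>env_group Q (\<rhd>)\<^esub> env_gen Q (\<rhd>) y =
    env_gen Q (\<rhd>) (env_theta Q (\<rhd>) g y) \<otimes>\<^bsub>env_group Q (\<rhd>)\<^esub> g"
  using assms
proof (induction arbitrary: y rule: env_group_induct)
  interpret th: group_hom "env_group Q (\<rhd>)" "Inn Q (\<rhd>)" "env_theta Q (\<rhd>)"
    using group_env_group group_Inn env_theta(1)
    by (auto simp: group_hom_def group_hom_axioms_def)
  {
    case one
    then show ?case by (simp add: Inn_one_apply env_gen_closed)
  next
    case (gen x)
    then show ?case by (simp add: env_theta(2) left_trans_def env_gen_conj)
  next
    case (inv_gen x)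
    let ?z = "env_theta Q (\<rhd>) (inv\<^bsub>env_group Q (\<rhd>)\<^esub> env_gen Q (\<rhd>) x) y"
    have x: "env_gen Q (\<rhd>) x \<in> carrier (env_group Q (\<rhd>))" using inv_gen by (simp add: env_gen_closed)
    have z: "?z \<in> Q"
      by (rule Inn_closed[OF th.hom_closed inv_gen(2)]) (use x in simp)
    have z_eq: "?z = (inv\<^bsub>Inn Q (\<rhd>)\<^esub> left_trans Q (\<rhd>) x) y"
      using inv_gen x by (simp add: env_theta(2))
    have "x \<rhd> ?z = left_trans Q (\<rhd>) x ?z" using z by (simp add: left_trans_def)
    also have "\<dots> =
        (left_trans Q (\<rhd>) x \<otimes>\<^bsub>Inn Q (\<rhd>)\<^esub> inv\<^bsub>Inn Q (\<rhd>)\<^esub> left_trans Q (\<rhd>) x) y"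
      unfolding z_eq using inv_gen left_trans_Inn by (intro Inn_mult_apply[symmetric]) simp_all
    also have "\<dots> = y" using inv_gen by (simp add: left_trans_Inn Inn_one_apply)
    finally have "env_gen Q (\<rhd>) x \<otimes>\<^bsub>env_group Q (\<rhd>)\<^esub> env_gen Q (\<rhd>) ?z =
      env_gen Q (\<rhd>) y \<otimes>\<^bsub>env_group Q (\<rhd>)\<^esub> env_gen Q (\<rhd>) x"
      using env_gen_conj[OF inv_gen(1) z] by (simp only:)
    then have "env_gen Q (\<rhd>) y = env_gen Q (\<rhd>) x \<otimes>\<^bsub>env_group Q (\<rhd>)\<^esub> env_gen Q (\<rhd>) ?z
        \<otimes>\<^bsub>env_group Q (\<rhd>)\<^esub> inv\<^bsub>env_group Q (\<rhd>)\<^esub> env_gen Q (\<rhd>) x"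
      using x env_gen_closed[OF z] env_gen_closed[OF inv_gen(2)]
      by (intro iffD2[OF th.G.inv_solve_right]) simp_all
    then show ?case
      using x env_gen_closed[OF z] env_gen_closed[OF inv_gen(2)]
      by (intro iffD2[OF th.G.inv_solve_left']) (simp_all add: th.G.m_assoc)
  next
    case (mult g h)
    let ?z = "env_theta Q (\<rhd>) h y"
    have z: "?z \<in> Q" using Inn_closed[OF th.hom_closed mult.prems] mult.hyps by simp
    have gz: "env_theta Q (\<rhd>) g ?z \<in> Q" using Inn_closed[OF th.hom_closed z] mult.hyps by simp
    note car = mult.hyps env_gen_closed[OF mult.prems] env_gen_closed[OF z] env_gen_closed[OF gz]
    have "g \<otimes>\<^bsub>env_group Q (\<rhd>)\<^esub> h \<otimes>\<^bsub>env_group Q (\<rhd>)\<^esub> env_gen Q (\<rhd>) y =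
      g \<otimes>\<^bsub>env_group Q (\<rhd>)\<^esub> env_gen Q (\<rhd>) ?z \<otimes>\<^bsub>env_group Q (\<rhd>)\<^esub> h"
      using car mult.IH(2)[OF mult.prems] by (simp add: th.G.m_assoc)
    also have "\<dots> = env_gen Q (\<rhd>) (env_theta Q (\<rhd>) g ?z) \<otimes>\<^bsub>env_group Q (\<rhd>)\<^esub>
      (g \<otimes>\<^bsub>env_group Q (\<rhd>)\<^esub> h)"
      using car mult.IH(1)[OF z] by (simp add: th.G.m_assoc)
    also have "env_theta Q (\<rhd>) g ?z = env_theta Q (\<rhd>) (g \<otimes>\<^bsub>env_group Q (\<rhd>)\<^esub> h) y"
      using mult.hyps mult.prems by (simp add: Inn_mult_apply)
    finally show ?case .
  }
qed

lemma env_theta_kernel_commutes: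
  assumes "g \<in> carrier (env_group Q (\<rhd>))" "env_theta Q (\<rhd>) g = \<one>\<^bsub>Inn Q (\<rhd>)\<^esub>" "y \<in> Q"
  shows "g \<otimes>\<^bsub>env_group Q (\<rhd>)\<^esub> env_gen Q (\<rhd>) y = env_gen Q (\<rhd>) y \<otimes>\<^bsub>env_group Q (\<rhd>)\<^esub> g"
  using env_conj[OF assms(1,3)] assms(2,3) by (simp add: Inn_one_apply)

end

section \<open>Descent to the inner group\<close>

lemma pgl_class_eq: "pgl_class sc f = {sc c \<circ> f | c. c \<noteq> 0}"
  by (auto simp: pgl_class_def r_coset_def scalars_def GL_def)

lemma pgl_class_self:
  assumes "vector_space sc"
  shows "f \<in> pgl_class sc f"
proof -
  interpret vector_space sc by (rule assms)
  show ?thesis unfolding pgl_class_eq by (auto intro!: exI[of _ 1])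
qed

lemma pgl_class_hom: "vector_space sc \<Longrightarrow> pgl_class sc \<in> hom (GL sc) (PGL sc)"
  using normal.r_coset_hom_Mod[OF scalars_normal, of sc] by (simp add: PGL_def pgl_class_def[abs_def])

lemma pgl_class_scale:
  assumes "vector_space sc" "c \<noteq> 0"
  shows "pgl_class sc (sc c \<circ> f) = pgl_class sc f"
proof -
  interpret vector_space sc by (rule assms)
  have "sc d \<circ> f = sc (d / c) \<circ> (sc c \<circ> f)" "sc d \<circ> (sc c \<circ> f) = sc (d * c) \<circ> f" for d
    using assms(2) by (auto simp: fun_eq_iff)
  then show ?thesis unfolding pgl_class_eq using assms(2)
    by (auto intro: exI[of _ "_ / c"] exI[of _ "_ * c"])
qed

text \<open>
  All representatives of the class of \<open>T\<close> give the same conjugate of \<open>f\<close>, since scalars commute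
  with linear maps.
\<close>

lemma proj_conj_pgl_class:
  fixes sV :: "complex \<Rightarrow> 'v::ab_group_add \<Rightarrow> 'v" and sW :: "complex \<Rightarrow> 'w::ab_group_add \<Rightarrow> 'w"
  assumes T: "T \<in> lin_iso sV sW" and eq: "T \<circ> f = f' \<circ> T" and f': "Vector_Spaces.linear sW sW f'"
  shows "proj_conj {sW c \<circ> T | c. c \<noteq> 0} (pgl_class sV f) = pgl_class sW f'"
proof -
  interpret T: Vector_Spaces.linear sV sW T using T by (simp add: lin_iso_def)
  interpret f': Vector_Spaces.linear sW sW f' by (rule f')
  have key: "(sW c \<circ> T) \<circ> (sV d \<circ> f) \<circ> inv_into UNIV (sW c \<circ> T) = sW d \<circ> f'" if c: "c \<noteq> 0" for c d
  proof
    fix w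
    have "bij (sW c)" by (rule o_bij[of "sW (inverse c)"]) (use c in \<open>auto simp: fun_eq_iff\<close>)
    then have "bij (sW c \<circ> T)" using T by (intro bij_comp) (auto simp: lin_iso_def)
    then have v: "(sW c \<circ> T) (inv_into UNIV (sW c \<circ> T) w) = w"
      by (simp only: bij_is_surj surj_f_inv_f)
    define v where "v = inv_into UNIV (sW c \<circ> T) w"
    have "((sW c \<circ> T) \<circ> (sV d \<circ> f)) v = sW d (sW c (T (f v)))"
      by (simp add: T.scale mult.commute)
    also have "\<dots> = sW d (sW c (f' (T v)))" using fun_cong[OF eq, of v] by simp
    also have "\<dots> = sW d (f' w)" using v by (simp add: v_def[symmetric] f'.scale[symmetric])
    finally show "((sW c \<circ> T) \<circ> (sV d \<circ> f) \<circ> inv_into UNIV (sW c \<circ> T)) w = (sW d \<circ> f') w"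
      by (simp add: v_def)
  qed
  show ?thesis
  proof
    show "proj_conj {sW c \<circ> T | c. c \<noteq> 0} (pgl_class sV f) \<subseteq> pgl_class sW f'"
      unfolding proj_conj_def pgl_class_eq using key by blast
    show "pgl_class sW f' \<subseteq> proj_conj {sW c \<circ> T | c. c \<noteq> 0} (pgl_class sV f)"
    proof
      fix h assume "h \<in> pgl_class sW f'"
      then obtain d where d: "d \<noteq> 0" "h = sW d \<circ> f'" unfolding pgl_class_eq by blast
      have "h = (sW 1 \<circ> T) \<circ> (sV d \<circ> f) \<circ> inv_into UNIV (sW 1 \<circ> T)"
        unfolding d(2) by (rule key[symmetric]) simp
      moreover have "sW 1 \<circ> T \<in> {sW c \<circ> T | c. c \<noteq> 0}" by (auto intro!: exI[of _ 1])
      moreover have "sV d \<circ> f \<in> pgl_class sV f" unfolding pgl_class_eq using d(1) by blast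
      ultimately show "h \<in> proj_conj {sW c \<circ> T | c. c \<noteq> 0} (pgl_class sV f)"
        unfolding proj_conj_def by blast
    qed
  qed
qed

lemma (in quandle) intertwiner_rep_env:
  assumes rep: "quandle_rep Q (\<rhd>) sV \<rho>" and rep': "quandle_rep Q (\<rhd>) sW \<rho>'"
    and T: "\<And>x. x \<in> Q \<Longrightarrow> T \<circ> \<rho> x = \<rho>' x \<circ> T" and g: "g \<in> carrier (env_group Q (\<rhd>))"
  shows "T \<circ> rep_env Q (\<rhd>) sV \<rho> g = rep_env Q (\<rhd>) sW \<rho>' g \<circ> T"
  using g
proof (induction rule: env_group_induct)
  let ?G = "env_group Q (\<rhd>)" and ?p = "rep_env Q (\<rhd>) sV \<rho>" and ?r = "rep_env Q (\<rhd>) sW \<rho>'"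
  have vs: "vector_space sV" "vector_space sW" using rep rep' by (simp_all add: quandle_rep_def)
  interpret p: group_hom ?G "GL sV" ?p
    using group_env_group[of Q "(\<rhd>)"] group_GL[OF vs(1)] rep_env(1)[OF quandle_axioms rep]
    by (simp add: group_hom_def group_hom_axioms_def)
  interpret r: group_hom ?G "GL sW" ?r
    using group_env_group[of Q "(\<rhd>)"] group_GL[OF vs(2)] rep_env(1)[OF quandle_axioms rep']
    by (simp add: group_hom_def group_hom_axioms_def)
  {
    case one
    then show ?case using p.hom_one r.hom_one by (simp add: GL_def)
  next
    case (gen x)
    then show ?case using T by (simp add: rep_env(2)[OF quandle_axioms rep] rep_env(2)[OF quandle_axioms rep'])
  next
    case (inv_gen x)
    let ?x = "env_gen Q (\<rhd>) x"
    have x: "?x \<in> carrier ?G" using inv_gen by (simp add: env_gen_closed)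
    have "?p ?x \<circ> ?p (inv\<^bsub>?G\<^esub> ?x) = id"
      using p.hom_mult[of ?x "inv\<^bsub>?G\<^esub> ?x"] p.hom_one x by (simp add: GL_def)
    then have "?r (inv\<^bsub>?G\<^esub> ?x) \<circ> T = ?r (inv\<^bsub>?G\<^esub> ?x) \<circ> (T \<circ> \<rho> x) \<circ> ?p (inv\<^bsub>?G\<^esub> ?x)"
      using rep_env(2)[OF quandle_axioms rep inv_gen] by (simp add: comp_assoc)
    also have "\<dots> = (?r (inv\<^bsub>?G\<^esub> ?x) \<circ> ?r ?x) \<circ> T \<circ> ?p (inv\<^bsub>?G\<^esub> ?x)"
      using T[OF inv_gen] rep_env(2)[OF quandle_axioms rep' inv_gen] by (simp add: comp_assoc)
    also have "?r (inv\<^bsub>?G\<^esub> ?x) \<circ> ?r ?x = id"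
      using r.hom_mult[of "inv\<^bsub>?G\<^esub> ?x" ?x] r.hom_one x by (simp add: GL_def)
    finally show ?case by simp
  next
    case (mult g h)
    have "?p (g \<otimes>\<^bsub>?G\<^esub> h) = ?p g \<circ> ?p h" "?r (g \<otimes>\<^bsub>?G\<^esub> h) = ?r g \<circ> ?r h"
      using p.hom_mult r.hom_mult mult by (simp_all add: GL_def)
    then show ?case using mult by (metis comp_assoc)
  }
qed

lemma irreducible_quandle_rep_imp_rep:
  "irreducible_quandle_rep Q qop sc \<rho> \<Longrightarrow> quandle_rep Q qop sc \<rho>"
  by (simp add: irreducible_quandle_rep_def)

text \<open>A finite quandle together with an irreducible representation of it.\<close>

locale irreducible_rep = quandle Q qop for Q :: "'q set" and qop (infixr "\<rhd>" 70) +
  fixes sV :: "complex \<Rightarrow> 'v::ab_group_add \<Rightarrow> 'v" and \<rho> :: "'q \<Rightarrow> 'v \<Rightarrow> 'v"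
  assumes fin: "finite Q" and irr: "irreducible_quandle_rep Q (\<rhd>) sV \<rho>"
begin

abbreviation "G \<equiv> env_group Q (\<rhd>)"
abbreviation "\<theta> \<equiv> env_theta Q (\<rhd>)"
abbreviation "\<rho>G \<equiv> rep_env Q (\<rhd>) sV \<rho>"

lemma rep: "quandle_rep Q (\<rhd>) sV \<rho>" and ne: "(UNIV :: 'v set) \<noteq> {0}"
  and irrD: "module.subspace sV W \<Longrightarrow> (\<And>x. x \<in> Q \<Longrightarrow> \<rho> x ` W \<subseteq> W) \<Longrightarrow> W = {0} \<or> W = UNIV"
  using irr by (auto simp: irreducible_quandle_rep_def)

lemma vs: "vector_space sV" using rep by (simp add: quandle_rep_def)

sublocale V: vector_space sV by (rule vs)

sublocale \<rho>: group_hom G "GL sV" \<rho>G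
  using group_env_group group_GL[OF vs] rep_env(1)[OF quandle_axioms rep]
  by (auto simp: group_hom_def group_hom_axioms_def)

sublocale \<theta>: group_hom G "Inn Q (\<rhd>)" \<theta>
  using group_env_group group_Inn env_theta(1) by (auto simp: group_hom_def group_hom_axioms_def)

lemma \<rho>G_gen: "x \<in> Q \<Longrightarrow> \<rho>G (env_gen Q (\<rhd>) x) = \<rho> x"
  by (rule rep_env(2)[OF quandle_axioms rep])

lemma \<rho>G_linear: "g \<in> carrier G \<Longrightarrow> Vector_Spaces.linear sV sV (\<rho>G g)"
  using \<rho>.hom_closed by (simp add: GL_def lin_iso_def)

lemma \<rho>_linear: "x \<in> Q \<Longrightarrow> Vector_Spaces.linear sV sV (\<rho> x)"
  using \<rho>G_linear[OF env_gen_closed] \<rho>G_gen by metis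

lemma \<rho>G_mult: "g \<in> carrier G \<Longrightarrow> h \<in> carrier G \<Longrightarrow> \<rho>G (g \<otimes>\<^bsub>G\<^esub> h) v = \<rho>G g (\<rho>G h v)"
  by (simp add: GL_def)

text \<open>The orbit of any nonzero vector under the enveloping group spans \<open>V\<close>.\<close>

lemma countable_spanning:
  obtains S where "countable S" "V.span S = UNIV"
proof -
  obtain v :: 'v where v: "v \<noteq> 0" using ne by auto
  define S where "S = (\<lambda>g. \<rho>G g v) ` carrier G"
  have "V.span S = {0} \<or> V.span S = UNIV"
  proof (rule irrD)
    show "V.subspace (V.span S)" by (rule V.subspace_span)
    fix x assume x: "x \<in> Q"
    interpret f: Vector_Spaces.linear sV sV "\<rho> x" by (rule \<rho>_linear[OF x])
    have "\<rho> x (\<rho>G g v) \<in> S" if "g \<in> carrier G" for g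
    proof -
      have "\<rho> x (\<rho>G g v) = \<rho>G (env_gen Q (\<rhd>) x \<otimes>\<^bsub>G\<^esub> g) v"
        using \<rho>G_mult[OF env_gen_closed[OF x] that] \<rho>G_gen[OF x] by simp
      moreover have "env_gen Q (\<rhd>) x \<otimes>\<^bsub>G\<^esub> g \<in> carrier G"
        using env_gen_closed[OF x] that by (rule \<rho>.G.m_closed)
      ultimately show ?thesis unfolding S_def by blast
    qed
    then have "\<rho> x ` S \<subseteq> S" by (auto simp: S_def)
    then have "V.span (\<rho> x ` S) \<subseteq> V.span S" by (rule V.span_mono)
    then show "\<rho> x ` V.span S \<subseteq> V.span S" using f.span_image by simp
  qed
  moreover have "v \<in> V.span S"
  proof (rule V.span_base)
    have "\<rho>G \<one>\<^bsub>G\<^esub> v = v" using \<rho>.hom_one by (simp add: GL_def)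
    then show "v \<in> S" unfolding S_def by (metis \<rho>.G.one_closed image_eqI)
  qed
  ultimately have "V.span S = UNIV" using v by auto
  moreover have "countable S" unfolding S_def using countable_env_group[OF fin] by blast
  ultimately show ?thesis using that by blast
qed

lemma kernel_scalar:
  assumes z: "z \<in> carrier G" "\<theta> z = \<one>\<^bsub>Inn Q (\<rhd>)\<^esub>"
  obtains c where "c \<noteq> 0" "\<rho>G z = sV c"
proof -
  obtain S where S: "countable S" "V.span S = UNIV" by (rule countable_spanning)
  have "\<exists>c. \<rho>G z = sV c"
  proof (rule schur_countable[OF \<rho>G_linear[OF z(1)] S ne, of "\<rho> ` Q"])
    show "Vector_Spaces.linear sV sV f" if "f \<in> \<rho> ` Q" for f using that \<rho>_linear by auto
    show "f (\<rho>G z v) = \<rho>G z (f v)" if f: "f \<in> \<rho> ` Q" for f v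
    proof -
      obtain x where x: "x \<in> Q" "f = \<rho> x" using f by auto
      show ?thesis
        using x(2) \<rho>G_gen[OF x(1)] \<rho>G_mult[OF z(1) env_gen_closed[OF x(1)], of v]
          \<rho>G_mult[OF env_gen_closed[OF x(1)] z(1), of v] env_theta_kernel_commutes[OF z x(1)] by simp
    qed
  qed (rule irrD, auto)
  then obtain c where c: "\<rho>G z = sV c" by blast
  moreover have "c \<noteq> 0"
  proof
    assume "c = 0"
    have "inj (\<rho>G z)" using \<rho>.hom_closed[OF z(1)] by (simp add: GL_def lin_iso_def bij_is_inj)
    then have "v = 0" for v :: 'v using c \<open>c = 0\<close> injD[of "\<rho>G z" v 0] by simp
    then show False using ne by auto
  qed
  ultimately show ?thesis using that by blast
qed

lemma pgl_class_cong:
  assumes g: "g \<in> carrier G" and h: "h \<in> carrier G" and eq: "\<theta> g = \<theta> h"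
  shows "pgl_class sV (\<rho>G g) = pgl_class sV (\<rho>G h)"
proof -
  have "\<theta> (g \<otimes>\<^bsub>G\<^esub> inv\<^bsub>G\<^esub> h) = \<one>\<^bsub>Inn Q (\<rhd>)\<^esub>" using g h eq by simp
  then obtain c where c: "c \<noteq> 0" "\<rho>G (g \<otimes>\<^bsub>G\<^esub> inv\<^bsub>G\<^esub> h) = sV c"
    using kernel_scalar[of "g \<otimes>\<^bsub>G\<^esub> inv\<^bsub>G\<^esub> h"] g h by blast
  have "\<rho>G g = \<rho>G (g \<otimes>\<^bsub>G\<^esub> inv\<^bsub>G\<^esub> h \<otimes>\<^bsub>G\<^esub> h)" using g h by (simp add: \<rho>.G.m_assoc)
  also have "\<dots> = sV c \<circ> \<rho>G h"
    using \<rho>G_mult[of "g \<otimes>\<^bsub>G\<^esub> inv\<^bsub>G\<^esub> h" h] g h by (simp only: fun_eq_iff o_apply c(2)) auto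
  finally show ?thesis by (simp add: pgl_class_scale[OF vs c(1)])
qed

lemma rep_Inn_hom:
  assumes s: "theta_section Q (\<rhd>) s"
  shows "rep_Inn Q (\<rhd>) sV \<rho> s \<in> hom (Inn Q (\<rhd>)) (PGL sV)"
proof -
  have s': "s a \<in> carrier G" "\<theta> (s a) = a" if "a \<in> carrier (Inn Q (\<rhd>))" for a
    using s that by (simp_all add: theta_section_def)
  show ?thesis
  proof (rule homI)
    fix a b assume a: "a \<in> carrier (Inn Q (\<rhd>))" and b: "b \<in> carrier (Inn Q (\<rhd>))"
    show "rep_Inn Q (\<rhd>) sV \<rho> s a \<in> carrier (PGL sV)"
      using s'[OF a] hom_in_carrier[OF pgl_class_hom[OF vs]] by (simp add: rep_Inn_def)
    have "pgl_class sV (\<rho>G (s (a \<otimes>\<^bsub>Inn Q (\<rhd>)\<^esub> b))) = pgl_class sV (\<rho>G (s a \<otimes>\<^bsub>G\<^esub> s b))"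
      using a b s' by (intro pgl_class_cong) simp_all
    then show "rep_Inn Q (\<rhd>) sV \<rho> s (a \<otimes>\<^bsub>Inn Q (\<rhd>)\<^esub> b) =
        rep_Inn Q (\<rhd>) sV \<rho> s a \<otimes>\<^bsub>PGL sV\<^esub> rep_Inn Q (\<rhd>) sV \<rho> s b"
      using a b s' hom_mult[OF pgl_class_hom[OF vs]] by (simp add: rep_Inn_def)
  qed
qed

lemma rep_Inn_independent:
  assumes "theta_section Q (\<rhd>) s" "theta_section Q (\<rhd>) t" "a \<in> carrier (Inn Q (\<rhd>))"
  shows "rep_Inn Q (\<rhd>) sV \<rho> s a = rep_Inn Q (\<rhd>) sV \<rho> t a"
  unfolding rep_Inn_def using assms by (intro pgl_class_cong) (simp_all add: theta_section_def)

lemma rep_Inn_left_trans: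
  assumes "theta_section Q (\<rhd>) s" "x \<in> Q"
  shows "rep_Inn Q (\<rhd>) sV \<rho> s (left_trans Q (\<rhd>) x) = pgl_class sV (\<rho> x)"
proof -
  have "pgl_class sV (\<rho>G (s (left_trans Q (\<rhd>) x))) = pgl_class sV (\<rho>G (env_gen Q (\<rhd>) x))"
    using assms by (intro pgl_class_cong)
      (simp_all add: theta_section_def left_trans_Inn env_gen_closed env_theta(2))
  then show ?thesis using assms(2) by (simp add: rep_Inn_def \<rho>G_gen)
qed

lemma rep_Inn_irreducible:
  assumes s: "theta_section Q (\<rhd>) s"
  shows "irreducible_projective_rep (Inn Q (\<rhd>)) sV (rep_Inn Q (\<rhd>) sV \<rho> s)"
  unfolding irreducible_projective_rep_def projective_rep_def
proof (intro conjI notI group_Inn vs rep_Inn_hom[OF s])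
  let ?r = "rep_Inn Q (\<rhd>) sV \<rho> s"
  assume "\<exists>S. proj_subspace sV S \<and> S \<noteq> {} \<and> S \<noteq> proj_points sV \<and>
    (\<forall>g\<in>carrier (Inn Q (\<rhd>)). \<forall>l\<in>S. proj_act (?r g) l \<in> S)"
  then obtain S where "proj_subspace sV S" and ne_S: "S \<noteq> {}" "S \<noteq> proj_points sV"
    and stable: "\<And>g l. g \<in> carrier (Inn Q (\<rhd>)) \<Longrightarrow> l \<in> S \<Longrightarrow> proj_act (?r g) l \<in> S"
    by (elim exE conjE) simp
  then obtain W where W: "V.subspace W" and S: "S = {l \<in> proj_points sV. l \<subseteq> W}"
    unfolding proj_subspace_def by (elim exE conjE)
  \<comment> \<open>Stability under the classes of the \<open>\<rho>(x)\<close>, which are the images of the \<open>L\<^sub>x\<close>, suffices.\<close>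
  have "W = {0} \<or> W = UNIV"
  proof (rule irrD[OF W])
    fix x assume x: "x \<in> Q"
    interpret f: Vector_Spaces.linear sV sV "\<rho> x" by (rule \<rho>_linear[OF x])
    show "\<rho> x ` W \<subseteq> W"
    proof clarify
      fix w assume w: "w \<in> W"
      show "\<rho> x w \<in> W"
      proof (cases "w = 0")
        case True
        then show ?thesis using w by (simp add: f.zero)
      next
        case False
        have "V.span {w} \<subseteq> W" using w W by (simp add: V.span_minimal)
        then have "V.span {w} \<in> S" using False by (auto simp: S proj_points_def)
        then have "proj_act (pgl_class sV (\<rho> x)) (V.span {w}) \<subseteq> W"
          using stable[OF left_trans_Inn[OF x]] by (simp add: rep_Inn_left_trans[OF s x] S)
        moreover have "\<rho> x w \<in> proj_act (pgl_class sV (\<rho> x)) (V.span {w})"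
          unfolding proj_act_def using pgl_class_self[OF vs, of "\<rho> x"] V.span_base[of w "{w}"] by blast
        ultimately show ?thesis by blast
      qed
    qed
  qed
  then show False
  proof
    assume W0: "W = {0}"
    obtain v where "v \<noteq> 0" "V.span {v} \<subseteq> {0}"
      using ne_S(1) unfolding S W0 proj_points_def by blast
    then show False using V.span_base[of v "{v}"] by blast
  qed (use ne_S(2) S in auto)
qed

lemma rep_Inn_equivalent:
  fixes sW :: "complex \<Rightarrow> 'w::ab_group_add \<Rightarrow> 'w"
  assumes rep': "quandle_rep Q (\<rhd>) sW \<rho>'" and "quandle_rep_equivalent Q sV \<rho> sW \<rho>'"
    and s: "theta_section Q (\<rhd>) s" and t: "theta_section Q (\<rhd>) t"
  shows "projectively_equivalent (Inn Q (\<rhd>)) sV (rep_Inn Q (\<rhd>) sV \<rho> s) sW (rep_Inn Q (\<rhd>) sW \<rho>' t)"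
proof -
  obtain T where T: "T \<in> lin_iso sV sW" and TQ: "\<And>x. x \<in> Q \<Longrightarrow> T \<circ> \<rho> x = \<rho>' x \<circ> T"
    using assms(2) unfolding quandle_rep_equivalent_def by blast
  show ?thesis
    unfolding projectively_equivalent_def
  proof (intro bexI ballI)
    show "{sW c \<circ> T | c. c \<noteq> 0} \<in> proj_transformations sV sW"
      unfolding proj_transformations_def using T by blast
    fix a assume a: "a \<in> carrier (Inn Q (\<rhd>))"
    then have ta: "t a \<in> carrier G" using t by (simp add: theta_section_def)
    have "rep_env Q (\<rhd>) sW \<rho>' (t a) \<in> carrier (GL sW)"
      using rep_env(1)[OF quandle_axioms rep'] ta by (rule hom_in_carrier)
    then have "Vector_Spaces.linear sW sW (rep_env Q (\<rhd>) sW \<rho>' (t a))"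
      by (simp add: GL_def lin_iso_def)
    then have "proj_conj {sW c \<circ> T | c. c \<noteq> 0} (rep_Inn Q (\<rhd>) sV \<rho> t a) = rep_Inn Q (\<rhd>) sW \<rho>' t a"
      unfolding rep_Inn_def
      by (intro proj_conj_pgl_class[OF T] intertwiner_rep_env[OF rep rep' TQ ta])
    \<comment> \<open>Irreducibility is known for \<open>\<rho>\<close> only, so the change of section is made on that side.\<close>
    then show "rep_Inn Q (\<rhd>) sW \<rho>' t a = proj_conj {sW c \<circ> T | c. c \<noteq> 0} (rep_Inn Q (\<rhd>) sV \<rho> s a)"
      by (simp add: rep_Inn_independent[OF s t a])
  qed
qed

end

theorem proposition2p8:
  fixes Q :: "'q set" and qop :: "'q \<Rightarrow> 'q \<Rightarrow> 'q"
    and sV :: "complex \<Rightarrow> 'v::ab_group_add \<Rightarrow> 'v" and \<rho> :: "'q \<Rightarrow> 'v \<Rightarrow> 'v"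
  assumes "quandle Q qop" and "finite Q"
    and "irreducible_quandle_rep Q qop sV \<rho>"
  shows
    "(\<forall>s. theta_section Q qop s \<longrightarrow>
        irreducible_projective_rep (Inn Q qop) sV (rep_Inn Q qop sV \<rho> s)) \<and>
     (\<forall>s t. theta_section Q qop s \<and> theta_section Q qop t \<longrightarrow>
        (\<forall>a \<in> carrier (Inn Q qop). rep_Inn Q qop sV \<rho> s a = rep_Inn Q qop sV \<rho> t a)) \<and>
     (\<forall>s. theta_section Q qop s \<longrightarrow>
        (\<forall>x\<in>Q. rep_Inn Q qop sV \<rho> s (left_trans Q qop x) = pgl_class sV (\<rho> x))) \<and>
     (\<forall>(sW :: complex \<Rightarrow> 'w::ab_group_add \<Rightarrow> 'w) \<rho>' s t.
        quandle_rep Q qop sW \<rho>' \<and> quandle_rep_equivalent Q sV \<rho> sW \<rho>' \<and>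
        theta_section Q qop s \<and> theta_section Q qop t \<longrightarrow>
        projectively_equivalent (Inn Q qop)
          sV (rep_Inn Q qop sV \<rho> s) sW (rep_Inn Q qop sW \<rho>' t)) \<and>
     (\<forall>(sW :: complex \<Rightarrow> 'w \<Rightarrow> 'w) \<rho>' s t.
        irreducible_quandle_rep Q qop sW \<rho>' \<and>
        theta_section Q qop s \<and> theta_section Q qop t \<and>
        \<not> projectively_equivalent (Inn Q qop)
            sV (rep_Inn Q qop sV \<rho> s) sW (rep_Inn Q qop sW \<rho>' t) \<longrightarrow>
        \<not> quandle_rep_equivalent Q sV \<rho> sW \<rho>')"
proof -
  interpret irreducible_rep Q qop sV \<rho>
    using assms by (simp add: irreducible_rep_def irreducible_rep_axioms_def)
  show ?thesis
    by (intro conjI allI impI ballI notI; (elim conjE)?)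
      (assumption | rule rep_Inn_irreducible rep_Inn_independent rep_Inn_left_trans
        rep_Inn_equivalent | (erule notE, rule rep_Inn_equivalent)
        | rule irreducible_quandle_rep_imp_rep)+
qed

end
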